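(* Let $m$ be a squarefree positive integer, $K_{-m}=\mathbb{Q}(i\sqrt{m})$, $\mathcal{O}$ an order in the ring of integers $\mathcal{O}_{-m}$ of $K_{-m}$, and $\mathcal{I}$ a nonzero ideal of $\mathcal{O}$. Let $\mathcal{E}_{\mathcal{I}}=\{(p,q)\in\mathcal{O}\times\mathcal{I}:\ \langle p,q\rangle=\mathcal{O}\}$, where $\langle p,q\rangle$ is the ideal of $\mathcal{O}$ generated by $p,q$. For $x\in\mathbb{C}-K_{-m}$ let $$c_{\mathcal{I}}(x)=\liminf_{(p,q)\in\mathcal{E}_{\mathcal{I}},\ |q|\to\infty}\ |q|^2\,\Big|x-\frac{p}{q}\Big|.$$ Then the set $\mathrm{Sp}_{\mathcal{I}}=\{c_{\mathcal{I}}(x): x\in\mathbb{C}-K_{-m}\}$ is a closed subset of $\mathbb{R}$. *)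

theory Defs
  imports
    "HOL-Analysis.Analysis"
    "HOL-Computational_Algebra.Computational_Algebra"
    "HOL-Algebra.Generated_Fields"
    "HOL-Algebra.Ideal"
    "HOL-Algebra.Algebraic_Closure_Type"
begin

abbreviation complex_ring :: "complex ring" where
  "complex_ring \<equiv> ring_of_type_algebra"

abbreviation ring_on :: "complex set \<Rightarrow> complex ring" where
  "ring_on A \<equiv> complex_ring\<lparr>carrier := A\<rparr>"

definition imag_quadratic_field :: "nat \<Rightarrow> complex set" where
  "imag_quadratic_field m = generate_field complex_ring {\<i> * complex_of_real (sqrt (real m))}"

definition imag_quadratic_integers :: "nat \<Rightarrow> complex set" where
  "imag_quadratic_integers m = {z \<in> imag_quadratic_field m. algebraic_int z}"

abbreviation int_scale :: "int \<Rightarrow> complex \<Rightarrow> complex" where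
  "int_scale n z \<equiv> of_int n * z"

definition free_int_module_of_rank :: "nat \<Rightarrow> complex set \<Rightarrow> bool" where
  "free_int_module_of_rank r M \<longleftrightarrow>
     (\<exists>B. finite B \<and> card B = r \<and> \<not> Modules.module.dependent int_scale B \<and>
          Modules.module.span int_scale B = M)"

text \<open>The rank of an order equals the degree of the field, which is 2 for an imaginary
  quadratic field.\<close>

definition imag_quadratic_order :: "nat \<Rightarrow> complex set \<Rightarrow> bool" where
  "imag_quadratic_order m R \<longleftrightarrow>
     subring R complex_ring \<and> R \<subseteq> imag_quadratic_integers m \<and> free_int_module_of_rank 2 R"

definition admissible_pairs :: "complex set \<Rightarrow> complex set \<Rightarrow> (complex \<times> complex) set" where
  "admissible_pairs R I = {(p, q). p \<in> R \<and> q \<in> I \<and> Idl\<^bsub>ring_on R\<^esub> {p, q} = R}"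

text \<open>The lower limit is taken in the extended reals and over the filter on \<open>admissible_pairs R I\<close>
  generated by the sets of pairs \<open>(p, q)\<close> with \<open>norm q \<ge> T\<close>. The term at \<open>q = 0\<close> is
  irrelevant, such pairs being eventually excluded.\<close>

definition approx_const :: "complex set \<Rightarrow> complex set \<Rightarrow> complex \<Rightarrow> ereal" where
  "approx_const R I x =
     Liminf (inf (filtercomap (\<lambda>(p, q). norm q) at_top) (principal (admissible_pairs R I)))
       (\<lambda>(p, q). ereal ((norm q)\<^sup>2 * norm (x - p / q)))"

definition approx_spectrum :: "nat \<Rightarrow> complex set \<Rightarrow> complex set \<Rightarrow> ereal set" where
  "approx_spectrum m R I = approx_const R I ` (UNIV - imag_quadratic_field m)"

lemma module_int_scale: "Modules.module int_scale"
  by unfold_locales (simp_all add: algebra_simps)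

lemma approx_const_altdef:
  "approx_const R I x =
     (SUP T. INF pq\<in>{(p, q) \<in> admissible_pairs R I. norm q \<ge> T}.
        ereal ((norm (snd pq))\<^sup>2 * norm (x - fst pq / snd pq)))" (is "_ = ?rhs")
proof -
  let ?A = "\<lambda>T. {(p, q) \<in> admissible_pairs R I. norm q \<ge> T}"
  let ?f = "\<lambda>pq. ereal ((norm (snd pq))\<^sup>2 * norm (x - fst pq / snd pq))"
  let ?F = "inf (filtercomap (\<lambda>(p, q). norm q) at_top) (principal (admissible_pairs R I))"
  have ev: "eventually P ?F \<longleftrightarrow> (\<exists>T. \<forall>pq\<in>?A T. P pq)" for P
    unfolding eventually_inf_principal eventually_filtercomap eventually_at_top_linorder
    by (fastforce intro: exI[of _ "\<lambda>r. r \<ge> _"])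
  have "approx_const R I x = Liminf ?F ?f"
    by (simp add: approx_const_def case_prod_unfold)
  also have "\<dots> = ?rhs"
  proof (rule antisym)
    show "Liminf ?F ?f \<le> ?rhs"
      unfolding Liminf_def
    proof (rule SUP_least)
      fix P assume "P \<in> {P. eventually P ?F}"
      then obtain T where T: "\<forall>pq\<in>?A T. P pq" using ev by auto
      have "Inf (?f ` Collect P) \<le> Inf (?f ` ?A T)"
        by (rule INF_superset_mono) (use T in auto)
      also have "\<dots> \<le> ?rhs" by (rule SUP_upper) simp
      finally show "Inf (?f ` Collect P) \<le> ?rhs" .
    qed
    show "?rhs \<le> Liminf ?F ?f"
    proof (rule SUP_least)
      fix T :: real
      have "eventually (\<lambda>pq. pq \<in> ?A T) ?F" using ev by blast
      then show "Inf (?f ` ?A T) \<le> Liminf ?F ?f"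
        unfolding Liminf_def by (intro SUP_upper2[of "\<lambda>pq. pq \<in> ?A T"]) simp_all
    qed
  qed
  finally show ?thesis .
qed

end

theory Submission
  imports Defs
begin

text \<open>Matrices \<open>(a, b; c, d)\<close> over the order with determinant 1 and \<open>c\<close> in the ideal act on the
  admissible pairs, and the form \<open>(p - x q) (p - y q) / (x - y)\<close> is invariant when they act on the
  points \<open>x\<close>, \<open>y\<close> as well. Completing a good approximation \<open>(p, q)\<close> of \<open>x\<close> to such a matrix \<open>g\<close>,
  the points \<open>g^(-1) x\<close> and \<open>g^(-1) \<infinity>\<close> have distance \<open>1 / (|q| |p - x q|)\<close>, and after a
  translation they stay bounded; so for a limit \<open>\<kappa> > 0\<close> of values of the spectrum there is a pair
  \<open>(\<xi>, \<eta>)\<close> at distance \<open>1 / \<kappa>\<close> close to which trajectories of points with values tending to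
  \<open>\<kappa>\<close> return infinitely often. Multiplying together the matrices of later and later, closer and closer
  returns yields a point whose trajectory follows these trajectories in turn, and its value is
  \<open>\<kappa>\<close>. An approximation of this point is compared with one of the followed points at the stage where
  its image leaves a fixed disc around \<open>\<xi>\<close>.

  Finiteness of the values comes from consecutive minimal vectors \<open>v\<close>, \<open>v'\<close> of Dirichlet's theorem:
  their determinant is bounded, so the matrix \<open>(v, v')\<close> lies in finitely many classes modulo the
  matrix group, and each class provides an admissible pair that is a bounded combination of \<open>v\<close>
  and \<open>v'\<close>.\<close>

section \<open>Existence of good approximations\<close>

text \<open>The lower limit is not a continuous function of the point: it sees only the far end of a
  trajectory, so the limit of points with values tending to \<open>\<kappa>\<close> may have a
  different value. A new point therefore has to be assembled from far ends, and the trajectories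
  used need to share nothing but returns close to one pair. The product \<open>|q| |p - x q|\<close>
  is not invariant under matrices; it is the modulus of the form with second root at infinity, and a
  finite root \<open>y\<close> changes it by at most \<open>|p - x q|^2 / |x - y|\<close>, which
  vanishes in the limit. Each vector is compared with a followed trajectory at one stage only, so
  errors do not accumulate along the product of matrices. The upper bound for the glued value comes
  from the images of \<open>(1, 0)\<close>, where the form equals \<open>1 / (x - y)\<close>.

  Discreteness enters as norms at least 1, and the non-real element \<open>w\<close> makes the order
  a lattice. Minimal vectors need neither be coprime nor have their second coordinate in the ideal,
  whence the detour through classes of matrices.\<close>

locale quadratic_ideal =
  fixes R I :: "complex set" and w :: complex
  assumes one_mem: "1 \<in> R"
    and diff_mem: "\<And>a b. a \<in> R \<Longrightarrow> b \<in> R \<Longrightarrow> a - b \<in> R"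
    and mult_mem: "\<And>a b. a \<in> R \<Longrightarrow> b \<in> R \<Longrightarrow> a * b \<in> R"
    and norm_ge_1: "\<And>a. a \<in> R \<Longrightarrow> a \<noteq> 0 \<Longrightarrow> 1 \<le> norm a"
    and w_mem: "w \<in> R" and Im_w: "Im w \<noteq> 0"
    and I_subset: "I \<subseteq> R"
    and I_add: "\<And>a b. a \<in> I \<Longrightarrow> b \<in> I \<Longrightarrow> a + b \<in> I"
    and I_mult: "\<And>a b. a \<in> R \<Longrightarrow> b \<in> I \<Longrightarrow> a * b \<in> I"
    and I_nonzero: "\<exists>t\<in>I. t \<noteq> 0"
begin

definition fracs :: "complex set" where
  "fracs = {a / b |a b. a \<in> R \<and> b \<in> R \<and> b \<noteq> 0}"

definition E :: "(complex \<times> complex) set" where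
  "E = {(p, q). p \<in> R \<and> q \<in> I \<and> (\<exists>a\<in>R. \<exists>b\<in>R. a * p + b * q = 1)}"

text \<open>The division is cleared by \<open>|q|^2 |x - p/q| = |q| |p - x q|\<close>. As
  \<open>c\<close> is real, the predicate also expresses that the lower limit is finite.\<close>

definition is_liminf :: "complex \<Rightarrow> real \<Rightarrow> bool" where
  "is_liminf x c \<longleftrightarrow>
     (\<forall>e>0. \<exists>Q. \<forall>p q. (p, q) \<in> E \<longrightarrow> Q \<le> norm q \<longrightarrow> c - e < norm q * norm (p - x * q)) \<and>
     (\<forall>e>0. \<forall>Q. \<exists>p q. (p, q) \<in> E \<and> Q \<le> norm q \<and> norm q * norm (p - x * q) < c + e)"

section \<open>Elementary properties of the ring and the ideal\<close>

lemma zero_mem: "0 \<in> R"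
  using diff_mem[OF one_mem one_mem] by simp

lemma uminus_mem: "a \<in> R \<Longrightarrow> - a \<in> R"
  using diff_mem[OF zero_mem] by simp

lemma add_mem: "a \<in> R \<Longrightarrow> b \<in> R \<Longrightarrow> a + b \<in> R"
  using diff_mem[of a "-b"] uminus_mem by simp

lemma of_nat_mem: "of_nat n \<in> R"
  by (induction n) (simp_all add: zero_mem one_mem add_mem)

lemma of_int_mem: "of_int n \<in> R"
  by (cases n rule: int_cases2) (simp_all add: of_nat_mem uminus_mem)

lemma power_mem: "a \<in> R \<Longrightarrow> a ^ n \<in> R"
  by (induction n) (simp_all add: one_mem mult_mem)

lemma I_mem: "a \<in> I \<Longrightarrow> a \<in> R"
  using I_subset by blast

lemma I_mult2: "b \<in> I \<Longrightarrow> a \<in> R \<Longrightarrow> b * a \<in> I"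
  using I_mult[of a b] by (simp add: mult.commute)

lemma I_uminus: "a \<in> I \<Longrightarrow> - a \<in> I"
  using I_mult[of "-1" a] uminus_mem[OF one_mem] by simp

lemma I_diff: "a \<in> I \<Longrightarrow> b \<in> I \<Longrightarrow> a - b \<in> I"
  using I_add[of a "-b"] I_uminus by simp

lemma zero_mem_I: "0 \<in> I"
  using I_nonzero I_diff by (metis diff_self)

lemmas R_closed = zero_mem one_mem diff_mem mult_mem uminus_mem add_mem

text \<open>Distinct elements have distance at least 1, since their difference lies in
  \<open>R\<close>; a bounded uniformly discrete set is finite.\<close>

lemma finite_norm_le: "finite {z \<in> R. norm z \<le> B}"
proof -
  have "uniform_discrete R"
    unfolding uniform_discrete_def
  proof (intro exI[of _ 1] conjI ballI impI)
    fix x y assume "x \<in> R" "y \<in> R" "dist x y < 1"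
    then show "x = y" using norm_ge_1[of "x - y"] diff_mem[of x y]
      by (force simp: dist_norm)
  qed simp
  then have "uniform_discrete {z \<in> R. norm z \<le> B}"
    by (rule uniform_discrete_subset) auto
  moreover have "bounded {z \<in> R. norm z \<le> B}"
    by (auto simp: bounded_iff)
  ultimately show ?thesis using uniform_discrete_finite_iff by blast
qed

lemma countable_R: "countable R"
proof -
  have "R = (\<Union>n. {z \<in> R. norm z \<le> real n})"
    using real_arch_simple by blast
  moreover have "countable (\<Union>n. {z \<in> R. norm z \<le> real n})"
    by (intro countable_UN[OF countableI_type] countable_finite finite_norm_le)
  ultimately show ?thesis by simp
qed

lemma countable_fracs: "countable fracs"
proof -
  have "fracs \<subseteq> (\<lambda>(a, b). a / b) ` (R \<times> R)"
    by (auto simp: fracs_def)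
  then show ?thesis
    using countable_R by (meson countable_SIGMA countable_image countable_subset)
qed

lemma not_fracs_linear_nonzero:
  assumes "x \<notin> fracs" "p \<in> R" "q \<in> R" "p \<noteq> 0 \<or> q \<noteq> 0"
  shows "p - x * q \<noteq> 0"
proof (cases "q = 0")
  case False
  have "x \<noteq> p / q" using assms(1-3) False unfolding fracs_def by blast
  then show ?thesis using False by (simp add: eq_divide_eq)
qed (use assms in simp)

section \<open>Lattice approximation, Dirichlet's theorem and minimal vectors\<close>

lemma real_basis: "\<exists>s t :: real. z = of_real s + of_real t * w"
proof (intro exI)
  show "z = of_real (Re z - Im z / Im w * Re w) + of_real (Im z / Im w) * w"
    using Im_w by (simp add: complex_eq_iff)
qed

text \<open>Bounds the norm on the fundamental parallelogram of the lattice spanned by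
  \<open>1\<close> and \<open>w\<close>.\<close>

definition cover_radius :: real where "cover_radius = 1 + norm w"

lemma cover_radius_ge: "1 \<le> cover_radius"
  by (simp add: cover_radius_def)

lemma near_R: "\<exists>r\<in>R. norm (z - r) \<le> cover_radius"
proof -
  obtain s t :: real where st: "z = of_real s + of_real t * w" using real_basis by blast
  let ?r = "of_int \<lfloor>s\<rfloor> + of_int \<lfloor>t\<rfloor> * w"
  have "z - ?r = of_real (frac s) + of_real (frac t) * w"
    by (simp add: st frac_def algebra_simps)
  also have "norm \<dots> \<le> frac s + frac t * norm w"
    by (rule norm_triangle_le) (simp add: norm_mult)
  also have "\<dots> \<le> 1 + 1 * norm w"
    by (intro add_mono mult_right_mono) (auto simp: less_imp_le frac_lt_1)
  finally have "norm (z - ?r) \<le> cover_radius" by (simp add: cover_radius_def)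
  moreover have "?r \<in> R" by (intro add_mem mult_mem of_int_mem w_mem)
  ultimately show ?thesis by blast
qed

text \<open>Pigeonhole: there are \<open>(m + 1)^2\<close> candidates \<open>i + j w\<close> for the
  denominator, but the coordinates of \<open>x * q\<close> modulo the lattice of \<open>1\<close>
  and \<open>w\<close> fall into \<open>m^2\<close> boxes. Two candidates in one box are
  subtracted.\<close>

lemma dirichlet_aux:
  assumes "m \<ge> (1::nat)"
  shows "\<exists>p\<in>R. \<exists>q\<in>R. (p \<noteq> 0 \<or> q \<noteq> 0) \<and> norm q \<le> m * cover_radius \<and>
    norm (p - x * q) \<le> cover_radius / m"
proof -
  obtain s t :: "complex \<Rightarrow> real" where st: "\<And>z. z = of_real (s z) + of_real (t z) * w"
    using real_basis by metis
  define q where "q = (\<lambda>(i, j). of_nat i + of_nat j * w)"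
  define box where "box = (\<lambda>ij. (nat \<lfloor>m * frac (s (x * q ij))\<rfloor>, nat \<lfloor>m * frac (t (x * q ij))\<rfloor>))"
  have lt: "nat \<lfloor>m * frac u\<rfloor> < m" for u :: real
  proof -
    have "m * frac u < m" using assms by (simp add: frac_lt_1)
    then have "\<lfloor>m * frac u\<rfloor> < int m" by (simp add: floor_less_iff)
    then show ?thesis using assms by linarith
  qed
  have "box ` ({..m} \<times> {..m}) \<subseteq> {..<m} \<times> {..<m}"
    using lt by (auto simp: box_def)
  then have "card (box ` ({..m} \<times> {..m})) \<le> card ({..<m} \<times> {..<m})"
    by (intro card_mono) auto
  also have "\<dots> < card ({..m} \<times> {..m})"
    by (simp add: card_cartesian_product)
  finally have "\<not> inj_on box ({..m} \<times> {..m})" by (rule pigeonhole)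
  then obtain i j i' j' where ij: "i \<le> m" "j \<le> m" "i' \<le> m" "j' \<le> m" "(i, j) \<noteq> (i', j')"
      and eq: "box (i, j) = box (i', j')"
    by (auto simp: inj_on_def)
  define u v where "u = x * q (i, j)" and "v = x * q (i', j')"
  have close: "\<bar>frac a - frac b\<bar> \<le> 1 / m" if "nat \<lfloor>m * frac a\<rfloor> = nat \<lfloor>m * frac b\<rfloor>" for a b :: real
  proof -
    have "\<lfloor>m * frac a\<rfloor> = \<lfloor>m * frac b\<rfloor>"
      using that by (simp add: nat_eq_iff split: if_splits)
    then have "\<bar>m * frac a - m * frac b\<bar> \<le> 1" by linarith
    also have "\<bar>m * frac a - m * frac b\<bar> = m * \<bar>frac a - frac b\<bar>"
      by (simp add: abs_mult flip: right_diff_distrib)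
    finally show ?thesis using assms by (simp add: field_simps)
  qed
  have cl: "\<bar>frac (s u) - frac (s v)\<bar> \<le> 1 / m" "\<bar>frac (t u) - frac (t v)\<bar> \<le> 1 / m"
    using eq by (auto simp: box_def u_def v_def intro!: close)
  define Q where "Q = q (i, j) - q (i', j')"
  define P where "P = of_int (\<lfloor>s u\<rfloor> - \<lfloor>s v\<rfloor>) + of_int (\<lfloor>t u\<rfloor> - \<lfloor>t v\<rfloor>) * w"
  have Q: "Q = of_int (int i - int i') + of_int (int j - int j') * w"
    by (simp add: Q_def q_def algebra_simps)
  have "Q \<noteq> 0"
  proof
    assume "Q = 0"
    then have "Im Q = 0" by simp
    then have "j = j'" using Im_w by (simp add: Q)
    with \<open>Q = 0\<close> have "i = i'" by (simp add: Q)
    with \<open>j = j'\<close> ij show False by simp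
  qed
  moreover have "P \<in> R" "Q \<in> R"
    unfolding P_def Q by (intro add_mem mult_mem of_int_mem w_mem)+
  moreover have "norm Q \<le> m * cover_radius"
  proof -
    have "norm Q \<le> \<bar>real_of_int (int i - int i')\<bar> + \<bar>real_of_int (int j - int j')\<bar> * norm w"
      unfolding Q by (rule norm_triangle_le) (simp add: norm_mult del: of_int_diff)
    also have "\<dots> \<le> m + m * norm w"
      by (intro add_mono mult_right_mono) (use ij in auto)
    finally show ?thesis by (simp add: cover_radius_def algebra_simps)
  qed
  moreover have "norm (P - x * Q) \<le> cover_radius / m"
  proof -
    have "x * Q = u - v" by (simp add: u_def v_def Q_def algebra_simps)
    also have "\<dots> = of_real (s u - s v) + of_real (t u - t v) * w"
      by (rule trans[OF arg_cong2[where f = minus, OF st[of u] st[of v]]]) (simp add: algebra_simps)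
    finally have "P - x * Q = - (of_real (frac (s u) - frac (s v)) + of_real (frac (t u) - frac (t v)) * w)"
      by (simp add: P_def frac_def algebra_simps)
    then have "norm (P - x * Q) = norm (of_real (frac (s u) - frac (s v)) + of_real (frac (t u) - frac (t v)) * w)"
      by (simp only: norm_minus_cancel)
    also have "\<dots> \<le> \<bar>frac (s u) - frac (s v)\<bar> + \<bar>frac (t u) - frac (t v)\<bar> * norm w"
      by (rule norm_triangle_le) (simp add: norm_mult del: of_real_diff)
    also have "\<dots> \<le> 1 / m + 1 / m * norm w"
      by (intro add_mono mult_right_mono cl) auto
    finally show ?thesis by (simp add: cover_radius_def add_divide_distrib)
  qed
  ultimately show ?thesis by blast
qed

lemma dirichlet:
  assumes "Q \<ge> cover_radius"
  shows "\<exists>p\<in>R. \<exists>q\<in>R. (p \<noteq> 0 \<or> q \<noteq> 0) \<and> norm q \<le> Q \<and> norm (p - x * q) \<le> 2 * cover_radius\<^sup>2 / Q"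
proof -
  \<comment> \<open>Rounding down loses at most a factor 2, as the quotient is at least 1; this is
    the 2 in the conclusion.\<close>
  define m where "m = nat \<lfloor>Q / cover_radius\<rfloor>"
  have pos: "cover_radius > 0" using cover_radius_ge by linarith
  have 1: "Q / cover_radius \<ge> 1" using assms pos by (simp add: field_simps)
  then have m: "m \<ge> 1" "real m \<le> Q / cover_radius" "Q / cover_radius \<le> 2 * real m"
  proof -
    have f: "1 \<le> \<lfloor>Q / cover_radius\<rfloor>" using 1 by (simp add: le_floor_iff)
    then have "real m = of_int \<lfloor>Q / cover_radius\<rfloor>" by (simp add: m_def)
    with f show "m \<ge> 1" "real m \<le> Q / cover_radius" "Q / cover_radius \<le> 2 * real m"
      by linarith+
  qed
  obtain p q where pq: "p \<in> R" "q \<in> R" "p \<noteq> 0 \<or> q \<noteq> 0" "norm q \<le> m * cover_radius"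
      "norm (p - x * q) \<le> cover_radius / m"
    using dirichlet_aux[OF m(1)] by blast
  have "m * cover_radius \<le> Q" using m(2) pos by (simp add: field_simps)
  moreover have "cover_radius / m \<le> 2 * cover_radius\<^sup>2 / Q"
    using m pos assms by (simp add: field_simps power2_eq_square)
  ultimately show ?thesis using pq by (meson order_trans)
qed

lemma finite_small_vectors:
  "finite {(p, q). p \<in> R \<and> q \<in> R \<and> norm q \<le> B \<and> norm (p - x * q) \<le> C}"
proof (rule finite_subset)
  show "{(p, q). p \<in> R \<and> q \<in> R \<and> norm q \<le> B \<and> norm (p - x * q) \<le> C}
    \<subseteq> {z \<in> R. norm z \<le> C + norm x * B} \<times> {z \<in> R. norm z \<le> B}"
  proof clarsimp
    fix p q assume q: "norm q \<le> B" "norm (p - x * q) \<le> C"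
    have "norm p \<le> norm (p - x * q) + norm (x * q)" by (metis add.commute norm_triangle_sub)
    also have "\<dots> \<le> C + norm x * B" using q by (intro add_mono) (auto simp: norm_mult mult_left_mono)
    finally show "norm p \<le> C + norm x * B" .
  qed
qed (intro finite_cartesian_product finite_norm_le)

text \<open>\<open>v\<close> minimises \<open>|p - x q|\<close> among the vectors with
  \<open>|q| \<le> N\<close>, and \<open>v'\<close> has the least \<open>|q|\<close>, called
  \<open>Q\<close>, among those that beat \<open>v\<close>. A Dirichlet vector for
  \<open>Q / 2\<close> has a denominator below \<open>Q\<close>, so it does not beat
  \<open>v\<close>, and this bounds both linear forms. The hypothesis on \<open>N\<close> makes
  Dirichlet available at \<open>Q / 2\<close>.\<close>

lemma consecutive_minimal_vectors:
  assumes x: "x \<notin> fracs" and N: "N \<ge> 2 * cover_radius"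
  obtains p q p' q' Q where "p \<in> R" "q \<in> R" "p' \<in> R" "q' \<in> R" "Q > N"
    "norm q \<le> Q" "norm q' \<le> Q" "norm (p - x * q) \<le> 4 * cover_radius\<^sup>2 / Q"
    "norm (p' - x * q') \<le> 4 * cover_radius\<^sup>2 / Q" "p * q' - p' * q \<noteq> 0"
proof -
  define L where "L = (\<lambda>(p, q). norm (p - x * q))"
  have pos: "cover_radius > 0" using cover_radius_ge by linarith
  define V where "V = {(p, q). p \<in> R \<and> q \<in> R \<and> (p \<noteq> 0 \<or> q \<noteq> 0)}"
  have Lpos: "L v > 0" if "v \<in> V" for v
    using that not_fracs_linear_nonzero[OF x] by (auto simp: V_def L_def)
  have fin: "finite {v \<in> V. norm (snd v) \<le> B \<and> L v \<le> C}" for B C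
    by (rule finite_subset[OF _ finite_small_vectors[of B x C]]) (auto simp: V_def L_def)
  \<comment> \<open>The cut at 1 makes the set finite, and \<open>(1, 0)\<close> lies in it, so a
    minimum over \<open>S\<close> is one over all vectors with \<open>|q| \<le> N\<close>.\<close>
  define S where "S = {v \<in> V. norm (snd v) \<le> N \<and> L v \<le> 1}"
  have S: "finite S" "(1, 0) \<in> S"
    using fin[of N 1] N pos by (auto simp: S_def V_def L_def R_closed)
  obtain v where v: "v \<in> S" "\<And>u. u \<in> S \<Longrightarrow> L v \<le> L u"
    using arg_min_if_finite(1)[of S L] arg_min_least[of S _ L] S by (metis empty_iff)
  have min1: "L v \<le> L u" if "u \<in> V" "norm (snd u) \<le> N" for u
  proof (cases "L u \<le> 1")
    case True
    then show ?thesis using v(2)[of u] that by (simp add: S_def)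
  next
    case False
    then show ?thesis using v(1) by (simp add: S_def)
  qed
  have vV: "v \<in> V" using v by (auto simp: S_def)
  note Lv = Lpos[OF vV]
  \<comment> \<open>Large enough for Dirichlet to produce a vector that beats \<open>v\<close>; this
    makes \<open>S'\<close> nonempty.\<close>
  define Q0 where "Q0 = max cover_radius (4 * cover_radius\<^sup>2 / L v)"
  have "Q0 \<ge> cover_radius" "Q0 > 0" using pos by (auto simp: Q0_def)
  then obtain p0 q0 where v0: "p0 \<in> R" "q0 \<in> R" "p0 \<noteq> 0 \<or> q0 \<noteq> 0" "norm (p0 - x * q0) \<le> 2 * cover_radius\<^sup>2 / Q0"
    using dirichlet[of Q0 x] by blast
  have "Q0 \<ge> 4 * cover_radius\<^sup>2 / L v" by (simp add: Q0_def)
  then have "L v * Q0 \<ge> 4 * cover_radius\<^sup>2" using Lv by (simp add: field_simps)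
  moreover have "cover_radius\<^sup>2 > 0" using pos by simp
  ultimately have "2 * cover_radius\<^sup>2 < L v * Q0" by linarith
  then have "2 * cover_radius\<^sup>2 / Q0 < L v" using \<open>Q0 > 0\<close> by (simp add: pos_divide_less_eq)
  then have v0': "(p0, q0) \<in> V" "L (p0, q0) < L v" using v0 by (auto simp: V_def L_def)
  define S' where "S' = {u \<in> V. norm (snd u) \<le> norm q0 \<and> L u < L v}"
  have S': "finite S'" "(p0, q0) \<in> S'"
    using v0' by (auto simp: S'_def intro: finite_subset[OF _ fin[of "norm q0" "L v"]])
  obtain v' where v': "v' \<in> S'" "\<And>u. u \<in> S' \<Longrightarrow> norm (snd v') \<le> norm (snd u)"
    using arg_min_if_finite(1)[of S' "norm \<circ> snd"] arg_min_least[of S' _ "norm \<circ> snd"] S'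
    by (metis comp_apply empty_iff)
  have min2: "norm (snd v') \<le> norm (snd u)" if "u \<in> V" "L u < L v" for u
  proof (cases "norm (snd u) \<le> norm q0")
    case True
    then show ?thesis using v'(2)[of u] that by (simp add: S'_def)
  next
    case False
    then show ?thesis using v'(1) by (simp add: S'_def)
  qed
  have v'V: "v' \<in> V" "L v' < L v" using v' by (auto simp: S'_def)
  define Q where "Q = norm (snd v')"
  have QN: "Q > N" using min1[OF v'V(1)] v'V(2) unfolding Q_def by linarith
  have Q2: "Q / 2 \<ge> cover_radius" using QN N by simp
  obtain p2 q2 where v2: "p2 \<in> R" "q2 \<in> R" "p2 \<noteq> 0 \<or> q2 \<noteq> 0" "norm q2 \<le> Q / 2"
      "norm (p2 - x * q2) \<le> 2 * cover_radius\<^sup>2 / (Q / 2)"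
    using dirichlet[OF Q2] by blast
  have "(p2, q2) \<in> V" using v2 by (simp add: V_def)
  moreover have "\<not> Q \<le> norm q2" using v2 Q2 pos by linarith
  ultimately have "L v \<le> L (p2, q2)" using min2[of "(p2, q2)"] unfolding Q_def snd_conv by linarith
  also have "\<dots> \<le> 4 * cover_radius\<^sup>2 / Q" using v2 by (simp add: L_def)
  finally have LQ: "L v \<le> 4 * cover_radius\<^sup>2 / Q" .
  obtain p q p' q' where eq: "v = (p, q)" "v' = (p', q')" by (metis surj_pair)
  \<comment> \<open>Proportional vectors would satisfy \<open>L v * Q = L v' * |q|\<close>,
    impossible since \<open>L v' < L v\<close> and \<open>|q| \<le> N < Q\<close>.\<close>
  have "p * q' - p' * q \<noteq> 0"
  proof
    assume "p * q' - p' * q = 0"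
    then have "(p - x * q) * q' = (p' - x * q') * q" by (simp add: algebra_simps)
    then have "norm ((p - x * q) * q') = norm ((p' - x * q') * q)" by (rule arg_cong)
    then have "L v * Q = L v' * norm q" by (simp add: norm_mult L_def Q_def eq)
    also have "\<dots> \<le> L v' * Q"
      using v QN Lpos[OF v'V(1)] by (intro mult_left_mono) (auto simp: S_def eq)
    also have "\<dots> < L v * Q"
      using v'V QN N pos by (intro mult_strict_right_mono) auto
    finally show False by simp
  qed
  then show ?thesis
    using that[of p q p' q' Q] vV v'V LQ QN v unfolding V_def S_def L_def eq Q_def by auto
qed

section \<open>Classes of integral matrices of bounded determinant\<close>

lemma finite_residues:
  assumes "s \<in> R" "s \<noteq> 0"
  obtains \<rho> where "finite (\<rho> ` R)" "\<And>z. z \<in> R \<Longrightarrow> \<exists>r\<in>R. z = \<rho> z + s * r"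
proof -
  \<comment> \<open>With \<open>r\<close> a lattice point near \<open>z / s\<close>, the remainder
    \<open>z - s * r\<close> has norm at most \<open>|s| * cover_radius\<close>. It need not be
    constant on residue classes; equal remainders force congruence, which is what counts.\<close>
  have "\<exists>r\<in>R. norm (z / s - r) \<le> cover_radius" for z by (rule near_R)
  then obtain r where r: "\<And>z. r z \<in> R" "\<And>z. norm (z / s - r z) \<le> cover_radius" by metis
  have "norm (z - s * r z) \<le> norm s * cover_radius" for z
  proof -
    have "norm (z - s * r z) = norm s * norm (z / s - r z)"
      using assms by (simp add: right_diff_distrib flip: norm_mult)
    then show ?thesis using r(2) by (simp add: mult_left_mono)
  qed
  then have "(\<lambda>z. z - s * r z) ` R \<subseteq> {z \<in> R. norm z \<le> norm s * cover_radius}"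
    using assms r(1) by (auto intro!: R_closed)
  then have "finite ((\<lambda>z. z - s * r z) ` R)"
    using finite_norm_le finite_subset by blast
  then show ?thesis using r(1) by (intro that[of "\<lambda>z. z - s * r z"]) auto
qed

text \<open>The pair is the first column of \<open>M * N^(-1)\<close> for \<open>M = (p, p'; q, q')\<close> and
  \<open>N = (a, a'; b, b')\<close>; the congruence modulo \<open>t * D\<close> makes this matrix integral and congruent
  to the identity modulo \<open>t\<close>.\<close>

lemma congruent_matrices:
  assumes t: "t \<in> I" and D: "D \<noteq> 0" "D = p * q' - p' * q" "D = a * b' - a' * b"
    and R: "p \<in> R" "q \<in> R" "p' \<in> R" "q' \<in> R" "a \<in> R" "b \<in> R" "a' \<in> R" "b' \<in> R"
    and e: "e1 \<in> R" "e2 \<in> R" "e3 \<in> R" "e4 \<in> R"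
    and eq: "p = a + t * D * e1" "p' = a' + t * D * e2" "q = b + t * D * e3" "q' = b' + t * D * e4"
  shows "(b' / D * p + - b / D * p', b' / D * q + - b / D * q') \<in> E"
proof -
  have "b' / D * p + - b / D * p' = (b' * p - b * p') / D" by (simp add: diff_divide_distrib)
  also have 6: "b' * p - b * p' = D * (1 + t * (e1 * b' - e2 * b))"
    unfolding eq D(3) by (simp add: algebra_simps)
  finally have 1: "b' / D * p + - b / D * p' = 1 + t * (e1 * b' - e2 * b)" using D(1) by simp
  have "b' / D * q + - b / D * q' = (b' * q - b * q') / D" by (simp add: diff_divide_distrib)
  also have 7: "b' * q - b * q' = D * (t * (e3 * b' - e4 * b))"
    unfolding eq D(3) by (simp add: algebra_simps)
  finally have 2: "b' / D * q + - b / D * q' = t * (e3 * b' - e4 * b)" using D(1) by simp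
  \<comment> \<open>Multiplicativity of the determinant for \<open>M * adj N\<close>. Divided by
    \<open>D^2\<close> it says that \<open>M * N^(-1)\<close> has determinant 1, so its second
    column supplies the Bezout coefficients for the first.\<close>
  have 3: "D * (p * q' - p' * q) = (b' * p - b * p') * (a * q' - a' * q) - (b' * q - b * q') * (a * p' - a' * p)"
    unfolding D(3) by (simp add: algebra_simps)
  have 4: "a * q' - a' * q = D * (1 + t * (a * e4 - a' * e3))"
    unfolding eq D(3) by (simp add: algebra_simps)
  have 5: "a * p' - a' * p = D * (t * (a * e2 - a' * e1))"
    unfolding eq D(3) by (simp add: algebra_simps)
  have "D * D = D * (1 + t * (e1 * b' - e2 * b)) * (D * (1 + t * (a * e4 - a' * e3)))
      - D * (t * (e3 * b' - e4 * b)) * (D * (t * (a * e2 - a' * e1)))"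
    using 3 unfolding 4 5 6 7 D(2)[symmetric] .
  also have "\<dots> = D * D * ((1 + t * (a * e4 - a' * e3)) * (1 + t * (e1 * b' - e2 * b))
      + - (t * (a * e2 - a' * e1)) * (t * (e3 * b' - e4 * b)))"
    by (simp add: algebra_simps)
  finally have "D * D = D * D * ((1 + t * (a * e4 - a' * e3)) * (1 + t * (e1 * b' - e2 * b))
      + - (t * (a * e2 - a' * e1)) * (t * (e3 * b' - e4 * b)))" .
  then have "(1 + t * (a * e4 - a' * e3)) * (1 + t * (e1 * b' - e2 * b))
      + - (t * (a * e2 - a' * e1)) * (t * (e3 * b' - e4 * b)) = 1"
    using D(1) by simp
  moreover have "1 + t * (a * e4 - a' * e3) \<in> R" "- (t * (a * e2 - a' * e1)) \<in> R"
    "1 + t * (e1 * b' - e2 * b) \<in> R" "t * (e3 * b' - e4 * b) \<in> I"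
    using t I_mem[OF t] R e by (auto intro!: R_closed I_mult2)
  ultimately show ?thesis unfolding E_def 1 2 by blast
qed

text \<open>Matrices are sorted by determinant and by remainders of their entries modulo
  \<open>t * D\<close>. There are finitely many classes, and within a class the coefficients come
  from one fixed representative, so their bound is independent of the matrix.\<close>

lemma combination_in_E:
  obtains C where "C > 0" "\<And>p q p' q'. p \<in> R \<Longrightarrow> q \<in> R \<Longrightarrow> p' \<in> R \<Longrightarrow> q' \<in> R \<Longrightarrow>
    p * q' - p' * q \<noteq> 0 \<Longrightarrow> norm (p * q' - p' * q) \<le> B \<Longrightarrow>
    \<exists>u u'. norm u \<le> C \<and> norm u' \<le> C \<and> (u * p + u' * p', u * q + u' * q') \<in> E"
proof -
  obtain t where t: "t \<in> I" "t \<noteq> 0" using I_nonzero by blast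
  have "\<exists>\<rho>. finite (\<rho> ` R) \<and> (\<forall>z\<in>R. \<exists>r\<in>R. z = \<rho> z + s * r)" if "s \<in> R" "s \<noteq> 0" for s
    using finite_residues[OF that] by metis
  then obtain \<rho> where \<rho>: "\<And>s. s \<in> R \<Longrightarrow> s \<noteq> 0 \<Longrightarrow> finite (\<rho> s ` R)"
      "\<And>s z. s \<in> R \<Longrightarrow> s \<noteq> 0 \<Longrightarrow> z \<in> R \<Longrightarrow> \<exists>r\<in>R. z = \<rho> s z + s * r"
    by metis
  define det :: "complex \<times> complex \<times> complex \<times> complex \<Rightarrow> complex"
    where "det = (\<lambda>(p, q, p', q'). p * q' - p' * q)"
  define M where "M = {A \<in> R \<times> R \<times> R \<times> R. det A \<noteq> 0 \<and> norm (det A) \<le> B}"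
  define \<kappa> where "\<kappa> = (\<lambda>A. (det A, case A of (p, q, p', q') \<Rightarrow>
     (\<rho> (t * det A) p, \<rho> (t * det A) q, \<rho> (t * det A) p', \<rho> (t * det A) q')))"
  have det_mem: "det A \<in> R" if "A \<in> R \<times> R \<times> R \<times> R" for A
    using that by (auto simp: det_def intro!: R_closed)
  have "\<kappa> ` M \<subseteq> Sigma {z \<in> R - {0}. norm z \<le> B}
      (\<lambda>D. \<rho> (t * D) ` R \<times> \<rho> (t * D) ` R \<times> \<rho> (t * D) ` R \<times> \<rho> (t * D) ` R)"
    using det_mem by (fastforce simp: \<kappa>_def M_def)
  moreover have "finite {z \<in> R - {0}. norm z \<le> B}"
    by (rule finite_subset[OF _ finite_norm_le[of B]]) auto
  then have "finite (Sigma {z \<in> R - {0}. norm z \<le> B}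
      (\<lambda>D. \<rho> (t * D) ` R \<times> \<rho> (t * D) ` R \<times> \<rho> (t * D) ` R \<times> \<rho> (t * D) ` R))"
    using t by (intro finite_SigmaI finite_cartesian_product \<rho>) (auto intro!: mult_mem simp: I_mem)
  ultimately have fin: "finite (\<kappa> ` M)" by (rule finite_subset)
  \<comment> \<open>\<open>inv_into\<close> selects the representative of a class;
    \<open>b' / D\<close> and \<open>- b / D\<close> are the coefficients of
    \<open>congruent_matrices\<close>.\<close>
  define u where "u = (\<lambda>k. case inv_into M \<kappa> k of (a, b, a', b') \<Rightarrow> norm (b' / fst k) + norm (- b / fst k))"
  obtain C where C: "C > 0" "\<And>k. k \<in> \<kappa> ` M \<Longrightarrow> u k \<le> C"
  proof
    show "0 < Max (insert 1 (u ` \<kappa> ` M))" using fin by (subst Max_gr_iff) auto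
    show "u k \<le> Max (insert 1 (u ` \<kappa> ` M))" if "k \<in> \<kappa> ` M" for k using that fin by (intro Max_ge) auto
  qed
  show ?thesis
  proof (rule that[OF C(1)])
    fix p q p' q' assume R: "p \<in> R" "q \<in> R" "p' \<in> R" "q' \<in> R"
      and D0: "p * q' - p' * q \<noteq> 0" "norm (p * q' - p' * q) \<le> B"
    define A where "A = (p, q, p', q')"
    define D where "D = det A"
    have AM: "A \<in> M" using R D0 by (auto simp: A_def M_def det_def)
    have D: "D \<noteq> 0" "D \<in> R" using AM det_mem by (auto simp: M_def D_def)
    obtain a b a' b' where N: "inv_into M \<kappa> (\<kappa> A) = (a, b, a', b')" by (metis surj_pair)
    have NM: "(a, b, a', b') \<in> M" "\<kappa> (a, b, a', b') = \<kappa> A"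
      using AM inv_into_into[of "\<kappa> A" \<kappa> M] f_inv_into_f[of "\<kappa> A" \<kappa> M] by (auto simp flip: N)
    have R': "a \<in> R" "b \<in> R" "a' \<in> R" "b' \<in> R" using NM by (auto simp: M_def)
    have D': "D = a * b' - a' * b" using NM(2) by (simp add: \<kappa>_def D_def det_def)
    have \<rho>eq: "\<rho> (t * D) a = \<rho> (t * D) p" "\<rho> (t * D) b = \<rho> (t * D) q"
      "\<rho> (t * D) a' = \<rho> (t * D) p'" "\<rho> (t * D) b' = \<rho> (t * D) q'"
      using NM(2) by (auto simp: \<kappa>_def A_def D_def)
    have tD: "t * D \<in> R" "t * D \<noteq> 0" using t D by (auto intro!: mult_mem simp: I_mem)
    have cong: "\<exists>e\<in>R. z = z' + t * D * e" if z: "z \<in> R" "z' \<in> R" "\<rho> (t * D) z' = \<rho> (t * D) z" for z z'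
    proof -
      obtain r r' where "r \<in> R" "r' \<in> R" "z = \<rho> (t * D) z + t * D * r" "z' = \<rho> (t * D) z' + t * D * r'"
        using \<rho>(2)[OF tD] z by metis
      then show ?thesis using z by (intro bexI[of _ "r - r'"]) (auto simp: algebra_simps intro: R_closed)
    qed
    obtain e1 where e1: "e1 \<in> R" "p = a + t * D * e1" using cong[of p a] R R' \<rho>eq by auto
    obtain e2 where e2: "e2 \<in> R" "p' = a' + t * D * e2" using cong[of p' a'] R R' \<rho>eq by auto
    obtain e3 where e3: "e3 \<in> R" "q = b + t * D * e3" using cong[of q b] R R' \<rho>eq by auto
    obtain e4 where e4: "e4 \<in> R" "q' = b' + t * D * e4" using cong[of q' b'] R R' \<rho>eq by auto
    note e = e1(1) e2(1) e3(1) e4(1) e1(2) e2(2) e3(2) e4(2)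
    have "(b' / D * p + - b / D * p', b' / D * q + - b / D * q') \<in> E"
      by (rule congruent_matrices[OF t(1) D(1) _ D' R R' e]) (simp add: D_def det_def A_def)
    moreover have "norm (b' / D) + norm (- b / D) \<le> C"
      using C(2)[of "\<kappa> A"] AM by (simp add: u_def N) (simp add: \<kappa>_def D_def)
    then have "norm (b' / D) \<le> C" "norm (- b / D) \<le> C" using norm_ge_zero[of "b' / D"] norm_ge_zero[of "- b / D"] by linarith+
    ultimately show "\<exists>u u'. norm u \<le> C \<and> norm u' \<le> C \<and> (u * p + u' * p', u * q + u' * q') \<in> E"
      by blast
  qed
qed

text \<open>Minimal vectors satisfy \<open>|q| \<le> Q\<close> and
  \<open>|p - x q| \<le> c0 / Q\<close>, so their determinant is at most \<open>2 * c0\<close>. A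
  combination with coefficients bounded by \<open>C\<close> loses a factor \<open>2 * C\<close> in
  each estimate, whence \<open>4 * C\<^sup>2 * c0\<close>, in which \<open>Q\<close>
  cancels.\<close>

lemma coprime_approximations:
  assumes x: "x \<notin> fracs"
  obtains K where "\<And>T. \<exists>p q. (p, q) \<in> E \<and> T \<le> norm q \<and> norm q * norm (p - x * q) \<le> K"
proof -
  have pos: "cover_radius > 0" using cover_radius_ge by linarith
  define c0 where "c0 = 4 * cover_radius\<^sup>2"
  have c0: "c0 > 0" using pos by (simp add: c0_def)
  obtain C where C: "C > 0" "\<And>p q p' q'. p \<in> R \<Longrightarrow> q \<in> R \<Longrightarrow> p' \<in> R \<Longrightarrow> q' \<in> R \<Longrightarrow>
    p * q' - p' * q \<noteq> 0 \<Longrightarrow> norm (p * q' - p' * q) \<le> 2 * c0 \<Longrightarrow>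
    \<exists>u u'. norm u \<le> C \<and> norm u' \<le> C \<and> (u * p + u' * p', u * q + u' * q') \<in> E"
    using combination_in_E by blast
  have "\<exists>p q. (p, q) \<in> E \<and> T \<le> norm q \<and> norm q * norm (p - x * q) \<le> 4 * C\<^sup>2 * c0" for T
  proof -
    \<comment> \<open>Serves to force \<open>|b| \<ge> T\<close>: \<open>\<mu>\<close> bounds
      \<open>|p - x q|\<close> from below for every nonzero vector with \<open>|q| \<le> T\<close>,
      the inserted 1 covering the vectors beyond the cut. It then suffices that the linear form of
      the combination is below \<open>\<mu>\<close>, which decides the choice of
      \<open>N\<close>.\<close>
    define S where "S = {(p, q). p \<in> R \<and> q \<in> R \<and> norm q \<le> T \<and> norm (p - x * q) \<le> 1} - {(0, 0)}"
    have finS: "finite S" unfolding S_def using finite_small_vectors[of T x 1] by (rule finite_Diff)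
    define \<mu> where "\<mu> = Min (insert 1 ((\<lambda>(p, q). norm (p - x * q)) ` S))"
    have \<mu>: "\<mu> > 0" unfolding \<mu>_def
    proof (subst Min_gr_iff)
      show "\<forall>a\<in>insert 1 ((\<lambda>(p, q). norm (p - x * q)) ` S). 0 < a"
      proof (intro ballI, elim insertE imageE)
        fix a v assume "a = (case v of (p, q) \<Rightarrow> norm (p - x * q))" "v \<in> S"
        moreover obtain p q where "v = (p, q)" by (metis surj_pair)
        ultimately show "0 < a" using not_fracs_linear_nonzero[OF x, of p q] by (auto simp: S_def)
      qed simp
    qed (use finS in auto)
    define N where "N = max (2 * cover_radius) (2 * C * c0 / \<mu>)"
    have "N \<ge> 2 * cover_radius" by (simp add: N_def)
    then obtain p q p' q' Q where v: "p \<in> R" "q \<in> R" "p' \<in> R" "q' \<in> R" "Q > N"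
      "norm q \<le> Q" "norm q' \<le> Q" "norm (p - x * q) \<le> c0 / Q"
      "norm (p' - x * q') \<le> c0 / Q" "p * q' - p' * q \<noteq> 0"
      using consecutive_minimal_vectors[OF x, of N] unfolding c0_def by metis
    have Q: "Q > 0" "Q > 2 * C * c0 / \<mu>" using v(5) pos by (auto simp: N_def)
    have "p * q' - p' * q = (p - x * q) * q' - (p' - x * q') * q" by (simp add: algebra_simps)
    also have "norm \<dots> \<le> norm (p - x * q) * norm q' + norm (p' - x * q') * norm q"
      by (metis norm_mult norm_triangle_ineq4)
    also have "\<dots> \<le> c0 / Q * Q + c0 / Q * Q"
      using v Q by (intro add_mono mult_mono) (auto simp: c0 less_imp_le)
    also have "\<dots> = 2 * c0" using Q by simp
    finally obtain u u' where u: "norm u \<le> C" "norm u' \<le> C" "(u * p + u' * p', u * q + u' * q') \<in> E"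
      using C(2) v by metis
    define a b where "a = u * p + u' * p'" and "b = u * q + u' * q'"
    have "norm b \<le> norm u * norm q + norm u' * norm q'"
      unfolding b_def by (metis norm_mult norm_triangle_ineq)
    also have "\<dots> \<le> C * Q + C * Q" using v u C by (intro add_mono mult_mono) auto
    finally have b: "norm b \<le> 2 * C * Q" by simp
    have "a - x * b = u * (p - x * q) + u' * (p' - x * q')" by (simp add: a_def b_def algebra_simps)
    also have "norm \<dots> \<le> norm u * norm (p - x * q) + norm u' * norm (p' - x * q')"
      by (metis norm_mult norm_triangle_ineq)
    also have "\<dots> \<le> C * (c0 / Q) + C * (c0 / Q)" using v u C by (intro add_mono mult_mono) auto
    finally have L: "norm (a - x * b) \<le> 2 * C * c0 / Q" by simp
    have "2 * C * c0 / Q < \<mu>" using Q \<mu> by (simp add: field_simps)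
    with L have lt: "norm (a - x * b) < \<mu>" by simp
    have ab: "a \<in> R" "b \<in> R" "(a, b) \<noteq> (0, 0)" using u(3) unfolding a_def b_def by (auto simp: E_def I_mem)
    have "T \<le> norm b"
    proof (rule ccontr)
      assume "\<not> T \<le> norm b"
      moreover have "norm (a - x * b) \<le> 1"
        using lt finS Min_le[of "insert 1 ((\<lambda>(p, q). norm (p - x * q)) ` S)" 1] unfolding \<mu>_def by force
      ultimately have "(a, b) \<in> S" using ab by (auto simp: S_def)
      then have "\<mu> \<le> norm (a - x * b)" unfolding \<mu>_def using finS by (intro Min_le) force+
      with lt show False by simp
    qed
    moreover have "norm b * norm (a - x * b) \<le> 2 * C * Q * (2 * C * c0 / Q)"
      using b L C Q by (intro mult_mono) auto
    then have "norm b * norm (a - x * b) \<le> 4 * C\<^sup>2 * c0"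
      using Q by (simp add: power2_eq_square)
    ultimately show ?thesis using u(3) unfolding a_def b_def by blast
  qed
  then show ?thesis using that by blast
qed

end

section \<open>The invariant form\<close>

text \<open>The binary quadratic form with roots \<open>x\<close> and \<open>y\<close>, scaled to
  discriminant 1. Letting \<open>y\<close> tend to infinity gives
  \<open>q * (p - x q)\<close>.\<close>

definition form :: "complex \<Rightarrow> complex \<Rightarrow> complex \<times> complex \<Rightarrow> complex" where
  "form x y = (\<lambda>(p, q). (p - x * q) * (p - y * q) / (x - y))"

lemma form_commute: "form y x v = - form x y v"
proof -
  have "x - y = - (y - x)" by simp
  then show ?thesis unfolding form_def by (cases v) (simp only: prod.case divide_minus_right mult.commute minus_minus)
qed

lemma norm_form_commute: "norm (form y x v) = norm (form x y v)"
  by (simp add: form_commute[of y x])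

section \<open>Moebius transformations and perturbation of roots\<close>

lemma mobius_linear:
  fixes a b c d x p q :: complex
  assumes "a * d - b * c = 1" "c * x + d \<noteq> 0"
  shows "(a * p + b * q) - (a * x + b) / (c * x + d) * (c * p + d * q) = (p - x * q) / (c * x + d)"
proof -
  have "(a * p + b * q) * (c * x + d) - (a * x + b) * (c * p + d * q) = (a * d - b * c) * (p - x * q)"
    by (simp add: algebra_simps)
  then show ?thesis using assms by (simp add: diff_divide_eq_iff)
qed

lemma mobius_diff:
  fixes a b c d x y :: complex
  assumes "a * d - b * c = 1" "c * x + d \<noteq> 0" "c * y + d \<noteq> 0"
  shows "(a * x + b) / (c * x + d) - (a * y + b) / (c * y + d) = (x - y) / ((c * x + d) * (c * y + d))"
proof -
  have "(a * x + b) * (c * y + d) - (a * y + b) * (c * x + d) = (a * d - b * c) * (x - y)"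
    by (simp add: algebra_simps)
  then show ?thesis using assms by (simp add: diff_frac_eq)
qed

lemma mobius_inverse:
  fixes a b c d z :: complex
  assumes "a * d - b * c = 1" "c * z + d \<noteq> 0"
  defines "Z \<equiv> (a * z + b) / (c * z + d)"
  shows "- c * Z + a = 1 / (c * z + d)" "(d * Z - b) / (- c * Z + a) = z"
proof -
  have "- c * (a * z + b) + a * (c * z + d) = a * d - b * c" by (simp add: algebra_simps)
  then have "- c * (a * z + b) + a * (c * z + d) = 1" using assms(1) by simp
  then show 1: "- c * Z + a = 1 / (c * z + d)"
    using assms(2) unfolding Z_def by (simp add: field_simps)
  have "d * (a * z + b) - b * (c * z + d) = (a * d - b * c) * z" by (simp add: algebra_simps)
  then have "d * (a * z + b) - b * (c * z + d) = z" using assms(1) by simp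
  then have "d * Z - b = z / (c * z + d)"
    using assms(2) unfolding Z_def by (simp add: field_simps)
  with 1 show "(d * Z - b) / (- c * Z + a) = z" using assms(2) by simp
qed

text \<open>The linear factors are divided by \<open>c * x + d\<close> and \<open>c * y + d\<close>,
  and the difference of the roots by the product of both.\<close>

lemma form_mobius:
  fixes a b c d x y p q :: complex
  assumes "a * d - b * c = 1" "c * x + d \<noteq> 0" "c * y + d \<noteq> 0"
  shows "form ((a * x + b) / (c * x + d)) ((a * y + b) / (c * y + d)) (a * p + b * q, c * p + d * q) = form x y (p, q)"
  using assms unfolding form_def prod.case mobius_linear[OF assms(1,2)] mobius_linear[OF assms(1,3)]
    mobius_diff[OF assms] by simp

text \<open>A root can be moved by \<open>t\<close> when the slope of the vector and the other root
  keep distance \<open>s\<close> from it: \<open>p - y q\<close> shrinks at most by the factor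
  \<open>1 - t / s\<close>, and \<open>x - y\<close> grows at most by \<open>1 + t / s\<close>. A
  relative error is uniform over all such vectors.\<close>

lemma form_perturb:
  fixes x y y' p q :: complex
  assumes y: "norm (y - y') \<le> t" and ts: "0 \<le> t" "t < s"
    and q: "s * norm q \<le> norm (p - y' * q)" and x: "s \<le> norm (x - y')"
  shows "(s - t) / (s + t) * norm (form x y' (p, q)) \<le> norm (form x y (p, q))"
proof -
  have s: "s > 0" using ts by linarith
  have "norm (p - y' * q) \<le> norm (p - y * q) + norm ((y - y') * q)"
    using norm_triangle_ineq[of "p - y * q" "(y - y') * q"] by (simp add: algebra_simps)
  also have "norm ((y - y') * q) \<le> t * norm q" using y by (simp add: norm_mult mult_right_mono)
  also have "t * norm q \<le> t / s * norm (p - y' * q)"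
    using mult_left_mono[OF q, of "t / s"] ts s by simp
  finally have 1: "(1 - t / s) * norm (p - y' * q) \<le> norm (p - y * q)" by (simp add: algebra_simps)
  have "norm (x - y) \<le> norm (x - y') + norm (y - y')" using norm_triangle_ineq[of "x - y'" "y' - y"] by (simp add: norm_minus_commute)
  also have "norm (y - y') \<le> t / s * norm (x - y')"
    using y mult_left_mono[OF x, of "t / s"] ts s by simp
  finally have 2: "norm (x - y) \<le> (1 + t / s) * norm (x - y')" by (simp add: algebra_simps)
  have "norm (x - y') \<le> norm (x - y) + norm (y - y')" using norm_triangle_ineq[of "x - y" "y - y'"] by simp
  then have 3: "norm (x - y) > 0" using x y ts by linarith
  have "(s - t) / (s + t) * norm (form x y' (p, q))
      = norm (p - x * q) * ((1 - t / s) * norm (p - y' * q)) / ((1 + t / s) * norm (x - y'))"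
  proof -
    have "(s - t) / (s + t) = (1 - t / s) / (1 + t / s)" using s ts by (simp add: field_simps)
    then show ?thesis by (simp add: form_def norm_mult norm_divide)
  qed
  also have "\<dots> \<le> norm (p - x * q) * norm (p - y * q) / norm (x - y)"
    using 1 2 3 by (intro frac_le mult_left_mono) auto
  also have "\<dots> = norm (form x y (p, q))" by (simp add: form_def norm_mult norm_divide)
  finally show ?thesis .
qed

text \<open>Replaces the limit of an infinite product: the images of \<open>D\<close> under longer
  and longer compositions are nested nonempty compact sets, and the left inverses recover the whole
  sequence from a common point.\<close>

lemma inverse_limit_point:
  fixes f g :: "nat \<Rightarrow> 'a::heine_borel \<Rightarrow> 'a"
  assumes D: "compact D" "D \<noteq> {}" and f: "\<And>n. continuous_on D (f n)" "\<And>n. f n ` D \<subseteq> D"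
    and g: "\<And>n z. z \<in> D \<Longrightarrow> g n (f n z) = z"
  shows "\<exists>U. (\<forall>n. U n \<in> D) \<and> (\<forall>n. U n = f n (U (Suc n)))"
proof -
  \<comment> \<open>\<open>h n\<close> composes the first \<open>n\<close> maps, with
    \<open>f 0\<close> applied last.\<close>
  define h where "h = rec_nat id (\<lambda>n k. k \<circ> f n)"
  have h: "h 0 = id" "h (Suc n) = h n \<circ> f n" for n by (simp_all add: h_def)
  have cont: "continuous_on D (h n)" for n
  proof (induction n)
    case (Suc n)
    then show ?case unfolding h using f by (meson continuous_on_compose continuous_on_subset)
  qed (simp add: h)
  have "\<Inter> (range (\<lambda>n. h n ` D)) \<noteq> {}"
  proof (rule compact_nest)
    show "compact (h n ` D)" for n using compact_continuous_image[OF cont D(1)] .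
    show "h n ` D \<noteq> {}" for n using D by simp
    have "h (Suc n) ` D \<subseteq> h n ` D" for n using f(2)[of n] by (auto simp: h)
    then show "h n ` D \<subseteq> h m ` D" if "m \<le> n" for m n using that by (rule lift_Suc_antimono_le)
  qed
  then obtain x where x: "\<And>n. x \<in> h n ` D" by blast
  define U where "U = rec_nat x g"
  have U: "U 0 = x" "U (Suc n) = g n (U n)" for n by (simp_all add: U_def)
  have eq: "U n = z" if "z \<in> D" "h n z = x" for n z
    using that
  proof (induction n arbitrary: z)
    case (Suc n)
    then have "U n = f n z" using f(2)[of n] by (auto simp: h)
    then show ?case using Suc.prems g by (simp add: U)
  qed (simp add: h U)
  have "U n \<in> D \<and> U n = f n (U (Suc n))" for n
  proof -
    obtain z where z: "z \<in> D" "x = h (Suc n) z" using x by blast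
    then have "h n (f n z) = x" by (simp add: h)
    moreover have "f n z \<in> D" using z f(2)[of n] by auto
    ultimately have "U n = f n z" using eq by blast
    moreover have "U (Suc n) = z" using eq[of z "Suc n"] z by simp
    ultimately show ?thesis using \<open>f n z \<in> D\<close> by simp
  qed
  then show ?thesis by meson
qed

section \<open>Action of the matrix group on admissible pairs\<close>

context quadratic_ideal
begin

text \<open>The Bezout coefficients are transformed by the inverse matrix; \<open>c \<in> I\<close>
  keeps the second coordinate in the ideal.\<close>

lemma E_act:
  assumes "(p, q) \<in> E" "a \<in> R" "b \<in> R" "c \<in> I" "d \<in> R" "a * d - b * c = 1"
  shows "(a * p + b * q, c * p + d * q) \<in> E"
proof -
  obtain r s where pq: "p \<in> R" "q \<in> I" "r \<in> R" "s \<in> R" "r * p + s * q = 1" using assms(1) by (auto simp: E_def)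
  have "(r * d - s * c) * (a * p + b * q) + (s * a - r * b) * (c * p + d * q)
      = (a * d - b * c) * (r * p + s * q)"
    by (simp add: algebra_simps)
  then have "(r * d - s * c) * (a * p + b * q) + (s * a - r * b) * (c * p + d * q) = 1"
    using pq(5) assms(6) by simp
  moreover have "r * d - s * c \<in> R" "s * a - r * b \<in> R" "a * p + b * q \<in> R" "c * p + d * q \<in> I"
    using pq assms by (auto intro!: diff_mem add_mem mult_mem I_add I_mult2[of c p] I_mult[of d q] simp: I_mem)
  ultimately show ?thesis unfolding E_def by blast
qed

lemma E_nonzero: "(p, q) \<in> E \<Longrightarrow> p \<noteq> 0 \<or> q \<noteq> 0"
  by (auto simp: E_def)

lemma E_mem: "(p, q) \<in> E \<Longrightarrow> p \<in> R \<and> q \<in> I"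
  by (auto simp: E_def)

lemma unit_vector_in_E: "(1, 0) \<in> E"
  unfolding E_def using one_mem zero_mem zero_mem_I by force

end

section \<open>Gluing return maps\<close>

text \<open>One return of a good trajectory to a neighbourhood of the geodesic \<open>(\<xi>, \<eta>)\<close>: the matrix
  \<open>(a, b; c, d)\<close> maps the pair \<open>(x2, y2)\<close> to \<open>(x1, y1)\<close>, both being close to \<open>(\<xi>, \<eta>)\<close>, and
  contracts a fixed disc around \<open>\<xi>\<close> to a small one, while its inverse does so around \<open>\<eta>\<close>.\<close>

locale return_map = quadratic_ideal +
  fixes \<xi> \<eta> :: complex and \<rho> \<kappa> \<delta> :: real and a b c d x1 y1 x2 y2 :: complex
  assumes mem: "a \<in> R" "b \<in> R" "c \<in> I" "d \<in> R" and det: "a * d - b * c = 1"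
    and near: "norm (x1 - \<xi>) \<le> \<delta>" "norm (y1 - \<eta>) \<le> \<delta>" "norm (x2 - \<xi>) \<le> \<delta>" "norm (y2 - \<eta>) \<le> \<delta>"
    and maps: "x1 = (a * x2 + b) / (c * x2 + d)" "y2 = (d * y1 - b) / (- c * y1 + a)"
    and expand: "\<And>z. norm (z - \<xi>) \<le> \<rho> \<Longrightarrow> 2 \<le> norm (c * z + d)"
    and contract: "\<And>z. norm (z - \<xi>) \<le> \<rho> \<Longrightarrow> norm ((a * z + b) / (c * z + d) - \<xi>) \<le> 2 * \<delta>"
    and inv_nonzero: "\<And>z. norm (z - \<eta>) \<le> \<rho> \<Longrightarrow> - c * z + a \<noteq> 0"
    and inv_contract: "\<And>z. norm (z - \<eta>) \<le> \<rho> \<Longrightarrow> norm ((d * z - b) / (- c * z + a) - \<eta>) \<le> 2 * \<delta>"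
    and image_inf: "2 \<le> norm c" "norm (a - \<xi> * c) \<le> \<rho> * norm c"
    and lower: "\<And>p q. (p, q) \<in> E \<Longrightarrow> norm (p - \<xi> * q) \<le> \<rho> * norm q \<Longrightarrow> \<kappa> - \<delta> \<le> norm (form x1 y1 (p, q))"

text \<open>The bound on \<open>\<rho>\<close> keeps the discs around \<open>\<xi>\<close> and
  \<open>\<eta>\<close> apart, and \<open>\<kappa>\<close> is the modulus at \<open>(1, 0)\<close>
  of the form with these roots. Different stages may stem from trajectories of different
  points.\<close>

locale return_sequence = quadratic_ideal +
  fixes \<xi> \<eta> :: complex and \<rho> \<kappa> :: real and \<delta> :: "nat \<Rightarrow> real"
    and a b c d x1 y1 x2 y2 :: "nat \<Rightarrow> complex"
  assumes return: "\<And>n. return_map R I w \<xi> \<eta> \<rho> \<kappa> (\<delta> n) (a n) (b n) (c n) (d n) (x1 n) (y1 n) (x2 n) (y2 n)"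
    and \<rho>: "0 < \<rho>" "4 * \<rho> \<le> norm (\<xi> - \<eta>)"
    and \<delta>: "\<And>n. 0 < \<delta> n" "\<And>n. 16 * \<delta> n \<le> \<rho>" "antimono \<delta>" "\<delta> \<longlonglongrightarrow> 0"
    and \<kappa>: "\<kappa> = 1 / norm (\<xi> - \<eta>)"
begin

lemmas mem = return_map.mem[OF return] and det = return_map.det[OF return]
  and near = return_map.near[OF return] and maps = return_map.maps[OF return]
  and expand = return_map.expand[OF return] and contract = return_map.contract[OF return]
  and inv_nonzero = return_map.inv_nonzero[OF return]
  and inv_contract = return_map.inv_contract[OF return]
  and image_inf = return_map.image_inf[OF return] and lower = return_map.lower[OF return]

section \<open>Return matrices acting on vectors\<close>

definition up :: "nat \<Rightarrow> complex \<times> complex \<Rightarrow> complex \<times> complex" where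
  "up n = (\<lambda>(p, q). (a n * p + b n * q, c n * p + d n * q))"

definition down :: "nat \<Rightarrow> complex \<times> complex \<Rightarrow> complex \<times> complex" where
  "down n = (\<lambda>(p, q). (d n * p - b n * q, - c n * p + a n * q))"

text \<open>Vectors whose slope \<open>p / q\<close> lies in the disc around \<open>\<xi>\<close>,
  written homogeneously; for \<open>q = 0\<close> only the zero vector remains.\<close>

definition cone :: "(complex \<times> complex) set" where
  "cone = {(p, q). norm (p - \<xi> * q) \<le> \<rho> * norm q}"

definition mob :: "nat \<Rightarrow> complex \<Rightarrow> complex" where
  "mob n z = (a n * z + b n) / (c n * z + d n)"

definition inv_mob :: "nat \<Rightarrow> complex \<Rightarrow> complex" where
  "inv_mob n z = (d n * z - b n) / (- c n * z + a n)"

lemma up_down: "up n (down n v) = v"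
proof -
  obtain p q where v: "v = (p, q)" by (metis surj_pair)
  have "a n * (d n * p - b n * q) + b n * (- c n * p + a n * q) = (a n * d n - b n * c n) * p"
    "c n * (d n * p - b n * q) + d n * (- c n * p + a n * q) = (a n * d n - b n * c n) * q"
    by (simp_all add: algebra_simps)
  then show ?thesis by (simp add: v up_def down_def det)
qed

lemma up_mem_E: "v \<in> E \<Longrightarrow> up n v \<in> E"
  using E_act mem det unfolding up_def by (cases v) auto

lemma down_mem_E: "v \<in> E \<Longrightarrow> down n v \<in> E"
proof (cases v)
  case (Pair p q)
  assume "v \<in> E"
  then have "(d n * p + - b n * q, - c n * p + a n * q) \<in> E"
    unfolding Pair using mem det[of n] by (intro E_act) (auto simp: uminus_mem I_uminus algebra_simps)
  then show ?thesis by (simp add: Pair down_def)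
qed

lemma two_delta: "2 * \<delta> n \<le> \<rho>"
  using \<delta>(1,2)[of n] by linarith

lemma mob_near: "norm (z - \<xi>) \<le> \<rho> \<Longrightarrow> norm (mob n z - \<xi>) \<le> \<rho>"
  using contract[of z n] two_delta[of n] unfolding mob_def by linarith

lemma mob_denom: "norm (z - \<xi>) \<le> \<rho> \<Longrightarrow> c n * z + d n \<noteq> 0"
  using expand[of z n] by fastforce

lemma inv_mob_mob: "norm (z - \<xi>) \<le> \<rho> \<Longrightarrow> inv_mob n (mob n z) = z"
  using mobius_inverse(2)[OF det[of n] mob_denom] by (simp add: inv_mob_def mob_def)

text \<open>For \<open>v = q * (z, 1)\<close> the image is
  \<open>(c z + d) * q * (mob n z, 1)\<close>, and \<open>expand\<close> bounds the factor
  \<open>c z + d\<close>.\<close>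

lemma cone_up:
  assumes "v \<in> cone"
  shows "up n v \<in> cone" "2 * norm (snd v) \<le> norm (snd (up n v))"
proof -
  obtain p q where v: "v = (p, q)" by (metis surj_pair)
  have pq: "norm (p - \<xi> * q) \<le> \<rho> * norm q" using assms by (simp add: v cone_def)
  have "up n v \<in> cone \<and> 2 * norm (snd v) \<le> norm (snd (up n v))"
  proof (cases "q = 0")
    case True
    then show ?thesis using pq by (simp add: v up_def cone_def)
  next
    case False
    define z where "z = p / q"
    have p: "p = z * q" using False by (simp add: z_def)
    have "norm (p - \<xi> * q) = norm (z - \<xi>) * norm q" by (simp add: p flip: norm_mult left_diff_distrib)
    then have z: "norm (z - \<xi>) \<le> \<rho>" using pq False by simp
    have u: "up n v = (mob n z * (c n * z + d n) * q, (c n * z + d n) * q)"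
    proof -
      have "a n * z + b n = mob n z * (c n * z + d n)" using mob_denom[OF z, of n] by (simp add: mob_def)
      then have "(a n * z + b n) * q = mob n z * (c n * z + d n) * q" by (rule arg_cong)
      then show ?thesis by (simp add: up_def v p algebra_simps)
    qed
    have "norm (mob n z * (c n * z + d n) * q - \<xi> * ((c n * z + d n) * q))
       = norm (mob n z - \<xi>) * norm ((c n * z + d n) * q)"
      by (simp add: algebra_simps flip: norm_mult)
    also have "\<dots> \<le> \<rho> * norm ((c n * z + d n) * q)"
      using mob_near[OF z, of n] by (intro mult_right_mono) auto
    finally have "up n v \<in> cone" by (simp add: u cone_def)
    moreover have "2 * norm q \<le> norm (c n * z + d n) * norm q"
      using expand[OF z, of n] by (intro mult_right_mono) auto
    ultimately show ?thesis unfolding u by (simp add: v norm_mult)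
  qed
  then show "up n v \<in> cone" "2 * norm (snd v) \<le> norm (snd (up n v))" by auto
qed

primrec downs :: "nat \<Rightarrow> complex \<times> complex \<Rightarrow> complex \<times> complex" where
  "downs 0 v = v"
| "downs (Suc n) v = down n (downs n v)"

text \<open>Composed in the order opposite to \<open>downs\<close>, so that \<open>ups n\<close>
  undoes \<open>downs n\<close>.\<close>

primrec ups :: "nat \<Rightarrow> complex \<times> complex \<Rightarrow> complex \<times> complex" where
  "ups 0 v = v"
| "ups (Suc n) v = ups n (up n v)"

lemma downs_mem_E: "v \<in> E \<Longrightarrow> downs n v \<in> E"
  by (induction n) (simp_all add: down_mem_E)

lemma ups_mem_E: "v \<in> E \<Longrightarrow> ups n v \<in> E"
  by (induction n arbitrary: v) (simp_all add: up_mem_E)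

lemma ups_cone: "v \<in> cone \<Longrightarrow> ups n v \<in> cone \<and> 2 ^ n * norm (snd v) \<le> norm (snd (ups n v))"
proof (induction n arbitrary: v)
  case (Suc n)
  have "2 ^ n * (2 * norm (snd v)) \<le> 2 ^ n * norm (snd (up n v))"
    using cone_up(2)[OF Suc.prems, of n] by (intro mult_left_mono) auto
  also have "\<dots> \<le> norm (snd (ups n (up n v)))"
    using Suc.IH[of "up n v"] cone_up(1)[OF Suc.prems, of n] by blast
  finally show ?case using Suc.IH[of "up n v"] cone_up(1)[OF Suc.prems, of n] by simp
qed simp

text \<open>As long as a vector stays in the cone every \<open>down\<close> step at least halves
  \<open>|q|\<close>, yet a nonzero element of \<open>R\<close> has norm at least 1.\<close>

lemma exit_cone:
  assumes "p \<in> R" "q \<in> R" "(p, q) \<noteq> 0"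
  shows "\<exists>n. downs n (p, q) \<notin> cone"
proof (rule ccontr)
  assume "\<nexists>n. downs n (p, q) \<notin> cone"
  then have co: "downs n (p, q) \<in> cone" for n by blast
  have R: "downs n (p, q) \<in> R \<times> R - {0}" for n
  proof (induction n)
    case (Suc n)
    have "down n (downs n (p, q)) \<noteq> 0"
    proof
      assume "down n (downs n (p, q)) = 0"
      then have "up n 0 = downs n (p, q)" using up_down[of n "downs n (p, q)"] by simp
      then show False using Suc by (simp add: up_def zero_prod_def)
    qed
    moreover have "down n (downs n (p, q)) \<in> R \<times> R"
      using Suc mem[of n] by (auto simp: down_def I_mem intro!: diff_mem add_mem mult_mem uminus_mem)
    ultimately show ?case by simp
  qed (use assms in auto)
  have "2 ^ n * norm (snd (downs n (p, q))) \<le> norm q" for n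
  proof (induction n)
    case (Suc n)
    have "2 * norm (snd (downs (Suc n) (p, q))) \<le> norm (snd (downs n (p, q)))"
      using cone_up(2)[OF co[of "Suc n"], of n] by (simp add: up_down)
    then have "2 ^ n * (2 * norm (snd (downs (Suc n) (p, q)))) \<le> 2 ^ n * norm (snd (downs n (p, q)))"
      by (intro mult_left_mono) auto
    then show ?case using Suc by (simp only: power_Suc2 mult.assoc)
  qed simp
  moreover have "1 \<le> norm (snd (downs n (p, q)))" for n
  proof (rule norm_ge_1)
    show "snd (downs n (p, q)) \<in> R" using R[of n] by auto
    show "snd (downs n (p, q)) \<noteq> 0"
      using R[of n] co[of n] by (auto simp: cone_def zero_prod_def)
  qed
  ultimately have "2 ^ n \<le> norm q" for n
    by (metis mult_left_mono mult.right_neutral order_trans zero_le_numeral zero_le_power)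
  moreover obtain n where "norm q < 2 ^ n" using real_arch_pow[of 2 "norm q"] by auto
  ultimately show False by (meson not_less)
qed

lemma unit_up_cone: "up n (1, 0) \<in> cone" "2 \<le> norm (snd (up n (1, 0)))"
  using image_inf[of n] by (auto simp: up_def cone_def)

end

text \<open>\<open>(U n, Y n)\<close> is the pair \<open>(U 0, \<eta>)\<close> after undoing the
  first \<open>n\<close> matrices. \<open>U n\<close> is determined by the later matrices, which
  draw it to \<open>\<xi>\<close>, and \<open>Y n\<close> by the earlier ones, which draw it to
  \<open>\<eta>\<close>.\<close>

locale return_orbit = return_sequence +
  fixes U Y :: "nat \<Rightarrow> complex"
  assumes U_near: "\<And>n. norm (U n - \<xi>) \<le> \<rho>" and U_eq: "\<And>n. U n = mob n (U (Suc n))"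
    and Y_0: "Y 0 = \<eta>" and Y_Suc: "\<And>n. Y (Suc n) = inv_mob n (Y n)"
begin

section \<open>The orbit of the glued point\<close>

lemma U_close: "norm (U n - \<xi>) \<le> 2 * \<delta> n"
  using contract[OF U_near[of "Suc n"], of n] U_eq[of n] by (simp add: mob_def)

text \<open>At \<open>n = 0\<close> the truncated subtraction gives \<open>\<delta> 0\<close>, which is harmless as \<open>Y 0 = \<eta>\<close>.\<close>

lemma Y_close: "norm (Y n - \<eta>) \<le> 2 * \<delta> (n - 1)"
proof (induction n)
  case 0
  then show ?case using \<delta>(1)[of 0] by (simp add: Y_0)
next
  case (Suc n)
  then have "norm (Y n - \<eta>) \<le> \<rho>" using two_delta[of "n - 1"] by linarith
  then show ?case using inv_contract[of "Y n" n] by (simp add: Y_Suc inv_mob_def)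
qed

lemma Y_near: "norm (Y n - \<eta>) \<le> \<rho>"
  using Y_close[of n] two_delta[of "n - 1"] by linarith

lemma mob_Y: "mob n (Y (Suc n)) = Y n" "c n * Y (Suc n) + d n \<noteq> 0"
proof -
  have nz: "- c n * Y n + a n \<noteq> 0" using inv_nonzero Y_near by blast
  have det': "d n * a n - (- b n) * (- c n) = 1" using det[of n] by (simp add: algebra_simps)
  note * = mobius_inverse[OF det' nz]
  show "mob n (Y (Suc n)) = Y n" using *(2) by (simp add: Y_Suc inv_mob_def mob_def)
  have "c n * Y (Suc n) + d n = 1 / (- c n * Y n + a n)"
    using *(1) by (simp add: Y_Suc inv_mob_def)
  then show "c n * Y (Suc n) + d n \<noteq> 0" using nz by simp
qed

lemma form_up: "form (U n) (Y n) (up n v) = form (U (Suc n)) (Y (Suc n)) v"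
proof -
  obtain p q where v: "v = (p, q)" by (metis surj_pair)
  show ?thesis
    using form_mobius[OF det mob_denom[OF U_near[of "Suc n"]] mob_Y(2), of n p q]
    unfolding mob_def[symmetric] mob_Y U_eq[of n, symmetric] by (simp add: up_def v)
qed

lemma form_downs: "form (U n) (Y n) (downs n v) = form (U 0) (Y 0) v"
  by (induction n) (simp_all add: up_down flip: form_up)

lemma form_ups: "form (U 0) (Y 0) (ups n v) = form (U n) (Y n) v"
  by (induction n arbitrary: v) (simp_all add: form_up)

text \<open>The linear form with root \<open>U n\<close> changes only by a factor, so its vanishing
  persists along the orbit, as does convergence to 0 at a fixed stage.\<close>

lemma linear_down:
  "fst (down n v) - U (Suc n) * snd (down n v) = (c n * U (Suc n) + d n) * (fst v - U n * snd v)"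
proof -
  obtain p q where pq: "down n v = (p, q)" by (metis surj_pair)
  then have v: "v = (a n * p + b n * q, c n * p + d n * q)" using up_down[of n v] by (simp add: up_def)
  have nz: "c n * U (Suc n) + d n \<noteq> 0" using mob_denom U_near by blast
  show ?thesis using mobius_linear[OF det nz, of p q] nz U_eq[of n] by (simp add: v pq[unfolded v] mob_def)
qed

text \<open>If \<open>U 0 = p / q\<close>, then \<open>downs n (p, q)\<close> stays on the line of
  slope \<open>U n\<close>, hence in the cone for all \<open>n\<close>, against
  \<open>exit_cone\<close>.\<close>

lemma U_not_fracs: "U 0 \<notin> fracs"
proof
  assume "U 0 \<in> fracs"
  then obtain p q where pq: "p \<in> R" "q \<in> R" "q \<noteq> 0" "U 0 = p / q" by (auto simp: fracs_def)
  have "fst (downs n (p, q)) - U n * snd (downs n (p, q)) = 0" for n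
    by (induction n) (use pq in \<open>auto simp: linear_down\<close>)
  then have "fst (downs n (p, q)) - \<xi> * snd (downs n (p, q)) = (U n - \<xi>) * snd (downs n (p, q))" for n
    by (simp add: algebra_simps)
  then have "downs n (p, q) \<in> cone" for n
    using U_near[of n] by (auto simp: cone_def case_prod_unfold norm_mult mult_right_mono)
  then show False using exit_cone[OF pq(1,2)] pq(3) by (auto simp: zero_prod_def)
qed

text \<open>One loss factor of \<open>form_perturb\<close> for each of the two roots moved in
  \<open>form_at_exit\<close>, with \<open>s = \<rho> / 2\<close> and
  \<open>t = 4 * \<delta> (n - 1)\<close>.\<close>

definition \<theta> :: "nat \<Rightarrow> real" where
  "\<theta> n = ((\<rho> / 2 - 4 * \<delta> (n - 1)) / (\<rho> / 2 + 4 * \<delta> (n - 1)))\<^sup>2 * (\<kappa> - \<delta> n)"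

text \<open>A root may be moved only where the slope of the vector is far from it. In the cone the
  slope is far from \<open>\<eta>\<close>, which allows exchanging \<open>y1 n\<close> and
  \<open>Y n\<close>; after the step it is outside the disc around \<open>\<xi>\<close>, which
  allows exchanging \<open>x2 n\<close> and \<open>U (Suc n)\<close>. The form with roots
  \<open>U n\<close>, \<open>y1 n\<close> mediates, since the step turns these roots into
  \<open>U (Suc n)\<close>, \<open>y2 n\<close>.\<close>

lemma form_at_exit:
  assumes v: "v \<in> E" "v \<in> cone" "down n v \<notin> cone"
  shows "\<theta> n \<le> norm (form (U n) (Y n) v)"
proof -
  define s where "s = \<rho> / 2"
  \<comment> \<open>Orbit points are within \<open>2 * \<delta>\<close> of the centres and the
    followed points within \<open>\<delta>\<close>, so 4 is ample; the index \<open>n - 1\<close> is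
    that of \<open>Y_close\<close>.\<close>
  define t where "t = 4 * \<delta> (n - 1)"
  obtain p q where pq: "v = (p, q)" by (metis surj_pair)
  obtain p' q' where pq': "down n v = (p', q')" by (metis surj_pair)
  have \<delta>n: "\<delta> n \<le> \<delta> (n - 1)" "\<delta> (Suc n) \<le> \<delta> (n - 1)" using \<delta>(3) by (auto intro: antimonoD)
  have ts: "0 \<le> t" "t < s" using \<delta>(1,2)[of "n - 1"] \<rho> by (auto simp: t_def s_def)
  have \<delta>p: "\<delta> n \<le> \<rho> / 16" using \<delta>(2)[of n] by simp
  define k where "k = (s - t) / (s + t)"
  have k: "0 \<le> k" using ts by (simp add: k_def)
  have x2: "norm (x2 n - \<xi>) \<le> \<rho>" using near(3)[of n] \<delta>p \<rho> by linarith
  have y1: "- c n * y1 n + a n \<noteq> 0" by (rule inv_nonzero) (use near(2)[of n] \<delta>p \<rho> in linarith)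
  have det': "d n * a n - (- b n) * (- c n) = 1" using det[of n] by (simp add: algebra_simps)
  have y2: "c n * y2 n + d n = 1 / (- c n * y1 n + a n)" "(a n * y2 n + b n) / (c n * y2 n + d n) = y1 n"
    using mobius_inverse[OF det' y1] by (simp_all add: maps(2)[of n])
  have y2': "c n * y2 n + d n \<noteq> 0" using y2(1) y1 by simp
  have up: "v = (a n * p' + b n * q', c n * p' + d n * q')"
    using up_down[of n v] by (simp add: up_def pq')
  have "\<kappa> - \<delta> n \<le> norm (form (x1 n) (y1 n) v)"
    using lower[of p q n] v by (simp add: pq cone_def)
  also have "form (x1 n) (y1 n) v = form (x2 n) (y2 n) (p', q')"
    unfolding up using form_mobius[OF det mob_denom[OF x2] y2', of p' q'] maps(1)[of n] y2(2) by simp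
  \<comment> \<open>\<open>form_perturb\<close> moves the second root, hence the swap.\<close>
  also have "norm \<dots> = norm (form (y2 n) (x2 n) (p', q'))" by (rule norm_form_commute)
  finally have 1: "\<kappa> - \<delta> n \<le> norm (form (y2 n) (x2 n) (p', q'))" .
  have 2: "k * norm (form (y2 n) (x2 n) (p', q')) \<le> norm (form (y2 n) (U (Suc n)) (p', q'))"
    unfolding k_def
  proof (rule form_perturb[OF _ ts])
    have "norm (U (Suc n) - x2 n) \<le> norm (U (Suc n) - \<xi>) + norm (x2 n - \<xi>)"
      using norm_triangle_ineq4[of "U (Suc n) - \<xi>" "x2 n - \<xi>"] by simp
    then show "norm (U (Suc n) - x2 n) \<le> t"
      using U_close[of "Suc n"] near(3)[of n] \<delta>n \<delta>(1)[of "n - 1"] by (simp add: t_def)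
    have "norm (p' - \<xi> * q') > \<rho> * norm q'" using v(3) by (simp add: pq' cone_def)
    moreover have "norm (p' - \<xi> * q') \<le> norm (p' - x2 n * q') + norm ((x2 n - \<xi>) * q')"
      using norm_triangle_ineq[of "p' - x2 n * q'" "(x2 n - \<xi>) * q'"] by (simp add: algebra_simps)
    moreover have "norm ((x2 n - \<xi>) * q') \<le> \<rho> / 2 * norm q'"
      unfolding norm_mult using near(3)[of n] \<delta>p \<rho> by (intro mult_right_mono) auto
    ultimately show "s * norm q' \<le> norm (p' - x2 n * q')" by (simp add: s_def)
    have "norm (\<xi> - \<eta>) \<le> norm (y2 n - x2 n) + norm (x2 n - \<xi>) + norm (y2 n - \<eta>)"
      using norm_triangle_ineq4[of "y2 n - \<eta>" "(y2 n - x2 n) + (x2 n - \<xi>)"]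
        norm_triangle_ineq[of "y2 n - x2 n" "x2 n - \<xi>"] by (simp add: norm_minus_commute)
    then show "s \<le> norm (y2 n - x2 n)" using near(3,4)[of n] \<delta>p \<rho> by (simp add: s_def)
  qed
  have "norm (form (y2 n) (U (Suc n)) (p', q')) = norm (form (U (Suc n)) (y2 n) (p', q'))"
    by (rule norm_form_commute)
  also have "form (U (Suc n)) (y2 n) (p', q') = form (U n) (y1 n) v"
    unfolding up using form_mobius[OF det mob_denom[OF U_near] y2', of "Suc n" p' q'] U_eq[of n] y2(2)
    by (simp add: mob_def)
  finally have 3: "norm (form (y2 n) (U (Suc n)) (p', q')) = norm (form (U n) (y1 n) v)" .
  have 4: "k * norm (form (U n) (y1 n) v) \<le> norm (form (U n) (Y n) v)"
    unfolding k_def pq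
  proof (rule form_perturb[OF _ ts])
    have "norm (Y n - y1 n) \<le> norm (Y n - \<eta>) + norm (y1 n - \<eta>)"
      using norm_triangle_ineq4[of "Y n - \<eta>" "y1 n - \<eta>"] by simp
    then show "norm (Y n - y1 n) \<le> t"
      using Y_close[of n] near(2)[of n] \<delta>n \<delta>(1)[of "n - 1"] by (simp add: t_def)
    have "norm (\<xi> - \<eta>) \<le> norm (\<xi> - y1 n) + norm (y1 n - \<eta>)"
      using norm_triangle_ineq[of "\<xi> - y1 n" "y1 n - \<eta>"] by simp
    then have far: "norm (\<xi> - y1 n) \<ge> 3 * \<rho>" using near(2)[of n] \<delta>p \<rho> by linarith
    have "norm ((\<xi> - y1 n) * q) \<le> norm (p - y1 n * q) + norm (p - \<xi> * q)"
      using norm_triangle_ineq4[of "p - y1 n * q" "p - \<xi> * q"] by (simp add: algebra_simps)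
    moreover have "norm ((\<xi> - y1 n) * q) \<ge> 3 * \<rho> * norm q"
      unfolding norm_mult using far by (intro mult_right_mono) auto
    moreover have "norm (p - \<xi> * q) \<le> \<rho> * norm q" using v(2) by (simp add: pq cone_def)
    moreover have "\<rho> * norm q \<ge> 0" using \<rho> by simp
    ultimately show "s * norm q \<le> norm (p - y1 n * q)" unfolding s_def by linarith
    have "norm (\<xi> - y1 n) \<le> norm (U n - y1 n) + norm (U n - \<xi>)"
      using norm_triangle_ineq4[of "U n - y1 n" "U n - \<xi>"] by simp
    then show "s \<le> norm (U n - y1 n)" using far U_near[of n] \<rho> by (simp add: s_def)
  qed
  have "\<theta> n = k * (k * (\<kappa> - \<delta> n))" by (simp add: \<theta>_def k_def s_def t_def power2_eq_square)
  also have "\<dots> \<le> k * (k * norm (form (y2 n) (x2 n) (p', q')))"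
    using 1 k by (intro mult_left_mono) auto
  also have "\<dots> \<le> k * norm (form (U n) (y1 n) v)" using 2 3 k by (intro mult_left_mono) auto
  also note 4
  finally show ?thesis .
qed

lemma \<theta>_tendsto: "\<theta> \<longlonglongrightarrow> \<kappa>"
proof -
  have 1: "(\<lambda>n. \<delta> (n - 1)) \<longlonglongrightarrow> 0"
    by (rule LIMSEQ_imp_Suc) (simp add: \<delta>(4))
  have "(\<lambda>n. ((\<rho> / 2 - 4 * \<delta> (n - 1)) / (\<rho> / 2 + 4 * \<delta> (n - 1)))\<^sup>2 * (\<kappa> - \<delta> n))
      \<longlonglongrightarrow> ((\<rho> / 2 - 4 * 0) / (\<rho> / 2 + 4 * 0))\<^sup>2 * (\<kappa> - 0)"
    using \<rho> by (intro tendsto_intros 1 \<delta>(4)) auto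
  then show ?thesis using \<rho> by (simp add: \<theta>_def[abs_def])
qed

section \<open>The lower limit at the glued point\<close>

lemma U_Y_dist: "2 * \<rho> \<le> norm (U n - Y n)"
proof -
  have "norm (\<xi> - \<eta>) \<le> norm (U n - Y n) + norm (U n - \<xi>) + norm (Y n - \<eta>)"
    using norm_triangle_ineq4[of "(U n - Y n) + (Y n - \<eta>)" "U n - \<xi>"]
      norm_triangle_ineq[of "U n - Y n" "Y n - \<eta>"] by simp
  then show ?thesis using \<rho> U_near[of n] Y_near[of n] by linarith
qed

text \<open>Substitute \<open>p - y q = (p - x q) + (x - y) q\<close>: the form and the product to
  be estimated differ by a multiple of the square of the small factor.\<close>

lemma form_eq:
  "form (U 0) (Y 0) (p, q) = (p - U 0 * q)\<^sup>2 / (U 0 - Y 0) + (p - U 0 * q) * q"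
proof -
  have "U 0 - Y 0 \<noteq> 0" using U_Y_dist[of 0] \<rho> by auto
  then show ?thesis by (simp add: form_def field_simps power2_eq_square)
qed

lemma form_bounds:
  "norm q * norm (p - U 0 * q) \<le> norm (form (U 0) (Y 0) (p, q)) + (norm (p - U 0 * q))\<^sup>2 / \<rho>"
  "norm (form (U 0) (Y 0) (p, q)) \<le> norm q * norm (p - U 0 * q) + (norm (p - U 0 * q))\<^sup>2 / \<rho>"
proof -
  define u where "u = (p - U 0 * q)\<^sup>2 / (U 0 - Y 0)"
  have "norm u = (norm (p - U 0 * q))\<^sup>2 / norm (U 0 - Y 0)"
    by (simp add: u_def norm_divide norm_power)
  also have "\<dots> \<le> (norm (p - U 0 * q))\<^sup>2 / \<rho>"
    using U_Y_dist[of 0] \<rho> by (intro divide_left_mono mult_pos_pos) auto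
  finally have u: "norm u \<le> (norm (p - U 0 * q))\<^sup>2 / \<rho>" .
  have f: "form (U 0) (Y 0) (p, q) = u + (p - U 0 * q) * q" by (simp add: form_eq u_def)
  show "norm (form (U 0) (Y 0) (p, q)) \<le> norm q * norm (p - U 0 * q) + (norm (p - U 0 * q))\<^sup>2 / \<rho>"
    using norm_triangle_ineq[of u "(p - U 0 * q) * q"] u by (simp add: f norm_mult mult.commute)
  show "norm q * norm (p - U 0 * q) \<le> norm (form (U 0) (Y 0) (p, q)) + (norm (p - U 0 * q))\<^sup>2 / \<rho>"
    using norm_triangle_ineq4[of "u + (p - U 0 * q) * q" u] u by (simp add: f norm_mult mult.commute)
qed

text \<open>Used to push the exit stage of better and better approximations to infinity, where
  \<open>\<theta>\<close> is close to \<open>\<kappa>\<close>.\<close>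

lemma downs_sequence_cone:
  fixes v :: "nat \<Rightarrow> complex \<times> complex"
  assumes L: "(\<lambda>k. fst (v k) - U 0 * snd (v k)) \<longlonglongrightarrow> 0"
    and q: "filterlim (\<lambda>k. norm (snd (v k))) at_top sequentially"
  shows "eventually (\<lambda>k. downs n (v k) \<in> cone) sequentially"
proof -
  have "(\<lambda>k. fst (downs n (v k)) - U n * snd (downs n (v k))) \<longlonglongrightarrow> 0 \<and>
     filterlim (\<lambda>k. norm (snd (downs n (v k)))) at_top sequentially"
  proof (induction n)
    case 0
    show ?case using L q by simp
  next
    case (Suc n)
    define u where "u = (\<lambda>k. downs n (v k))"
    have IH: "(\<lambda>k. fst (u k) - U n * snd (u k)) \<longlonglongrightarrow> 0"
        "filterlim (\<lambda>k. norm (snd (u k))) at_top sequentially"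
      using Suc.IH unfolding u_def by blast+
    let ?j = "c n * U (Suc n) + d n"
    have "(\<lambda>k. ?j * (fst (u k) - U n * snd (u k))) \<longlonglongrightarrow> ?j * 0"
      using IH by (intro tendsto_mult tendsto_const) auto
    then have 1: "(\<lambda>k. fst (down n (u k)) - U (Suc n) * snd (down n (u k))) \<longlonglongrightarrow> 0"
      by (simp add: linear_down)
    have nz: "?j \<noteq> 0" using mob_denom U_near by blast
    \<comment> \<open>The coefficient of \<open>q\<close> in the new denominator once
      \<open>p\<close> is written as \<open>U n * q\<close> plus a small term; it is nonzero, so the
      denominators still tend to infinity.\<close>
    have j': "a n - c n * U n = 1 / ?j"
      using mobius_inverse(1)[OF det nz] U_eq[of n] by (simp add: mob_def)
    then have pos: "norm (a n - c n * U n) > 0" using nz by simp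
    have "(\<lambda>k. - norm (c n * (fst (u k) - U n * snd (u k)))) \<longlonglongrightarrow> - norm (c n * 0)"
      using IH by (intro tendsto_minus tendsto_norm tendsto_mult tendsto_const) auto
    moreover have "filterlim (\<lambda>k. norm (a n - c n * U n) * norm (snd (u k))) at_top sequentially"
      using IH pos by (intro filterlim_tendsto_pos_mult_at_top[OF tendsto_const]) auto
    ultimately have "filterlim (\<lambda>k. - norm (c n * (fst (u k) - U n * snd (u k)))
        + norm (a n - c n * U n) * norm (snd (u k))) at_top sequentially"
      by (rule filterlim_tendsto_add_at_top)
    moreover have "- norm (c n * (fst (u k) - U n * snd (u k))) + norm (a n - c n * U n) * norm (snd (u k))
        \<le> norm (snd (down n (u k)))" for k
    proof -
      have "snd (down n (u k)) = (a n - c n * U n) * snd (u k) - c n * (fst (u k) - U n * snd (u k))"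
        by (simp add: down_def case_prod_unfold algebra_simps)
      then show ?thesis
        using norm_triangle_ineq2[of "(a n - c n * U n) * snd (u k)" "c n * (fst (u k) - U n * snd (u k))"]
        by (simp add: norm_mult)
    qed
    ultimately have "filterlim (\<lambda>k. norm (snd (down n (u k)))) at_top sequentially"
      using filterlim_at_top_mono by (metis (mono_tags, lifting) always_eventually)
    with 1 show ?case by (simp add: u_def)
  qed
  then have "eventually (\<lambda>k. norm (fst (downs n (v k)) - U n * snd (downs n (v k))) < 1) sequentially"
    "eventually (\<lambda>k. 2 / \<rho> \<le> norm (snd (downs n (v k)))) sequentially"
    by (auto simp: filterlim_at_top dest!: tendstoD[of _ _ _ 1])
  then show ?thesis
  proof eventually_elim
    case (elim k)
    define p q where "p = fst (downs n (v k))" and "q = snd (downs n (v k))"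
    have "norm (p - \<xi> * q) \<le> norm (p - U n * q) + norm ((U n - \<xi>) * q)"
      using norm_triangle_ineq[of "p - U n * q" "(U n - \<xi>) * q"] by (simp add: algebra_simps)
    also have "norm ((U n - \<xi>) * q) \<le> \<rho> / 2 * norm q"
      unfolding norm_mult using U_close[of n] \<delta>(1,2)[of n] by (intro mult_right_mono) auto
    also have "norm (p - U n * q) \<le> \<rho> / 2 * norm q"
      using elim \<rho> by (simp add: p_def q_def field_simps)
    finally show ?case by (simp add: cone_def case_prod_unfold p_def q_def)
  qed
qed

text \<open>Approximations with value at most \<open>\<kappa> - e\<close> would leave the cone later
  and later. At the exit the invariant form is at least \<open>\<theta>\<close>, and it exceeds the
  value by at most a vanishing square.\<close>

lemma liminf_lower:
  assumes e: "e > 0"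
  shows "\<exists>Q. \<forall>p q. (p, q) \<in> E \<longrightarrow> Q \<le> norm q \<longrightarrow> \<kappa> - e < norm q * norm (p - U 0 * q)"
proof (rule ccontr)
  assume "\<not> ?thesis"
  then have "\<forall>k::nat. \<exists>v. v \<in> E \<and> real k \<le> norm (snd v) \<and> norm (snd v) * norm (fst v - U 0 * snd v) \<le> \<kappa> - e"
    by (metis fst_conv snd_conv not_less)
  then obtain v where v: "\<And>k. v k \<in> E" "\<And>k::nat. real k \<le> norm (snd (v k))"
      "\<And>k. norm (snd (v k)) * norm (fst (v k) - U 0 * snd (v k)) \<le> \<kappa> - e"
    by metis
  define L where "L = (\<lambda>k. fst (v k) - U 0 * snd (v k))"
  have lim: "filterlim (\<lambda>k. norm (snd (v k))) at_top sequentially"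
    using filterlim_at_top_mono[OF filterlim_real_sequentially] v(2) by simp
  have L: "L \<longlonglongrightarrow> 0"
  proof (rule Lim_null_comparison)
    show "eventually (\<lambda>k. norm (L k) \<le> (\<kappa> - e) / real k) sequentially"
      using eventually_gt_at_top[of 0]
    proof eventually_elim
      case (elim k)
      have "real k * norm (L k) \<le> norm (snd (v k)) * norm (L k)" using v(2) by (intro mult_right_mono) auto
      also have "\<dots> \<le> \<kappa> - e" using v(3) by (simp add: L_def)
      finally show ?case using elim by (simp add: field_simps)
    qed
    show "(\<lambda>k. (\<kappa> - e) / real k) \<longlonglongrightarrow> 0" by (rule lim_const_over_n)
  qed
  have "eventually (\<lambda>n. \<kappa> - e / 2 < \<theta> n) sequentially"
    using \<theta>_tendsto e by (intro order_tendstoD) auto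
  then obtain N where N: "\<And>n. n \<ge> N \<Longrightarrow> \<kappa> - e / 2 < \<theta> n" by (auto simp: eventually_sequentially)
  have "eventually (\<lambda>k. \<forall>n\<in>{..N}. downs n (v k) \<in> cone) sequentially"
    using downs_sequence_cone L lim unfolding L_def by (intro eventually_ball_finite) auto
  moreover have "(\<lambda>k. (norm (L k))\<^sup>2 / \<rho>) \<longlonglongrightarrow> (norm (0::complex))\<^sup>2 / \<rho>"
    using \<rho> by (intro tendsto_intros L) auto
  then have "eventually (\<lambda>k. (norm (L k))\<^sup>2 / \<rho> < e / 2) sequentially"
    using e by (intro order_tendstoD) auto
  ultimately have "eventually (\<lambda>k. False) sequentially"
  proof eventually_elim
    case (elim k)
    obtain p q where pq: "v k = (p, q)" by (metis surj_pair)
    have "p \<in> R" "q \<in> R" "(p, q) \<noteq> 0"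
      using v(1)[of k] E_mem E_nonzero I_mem by (auto simp: pq zero_prod_def)
    then obtain n0 where "downs n0 (v k) \<notin> cone" using exit_cone pq by metis
    \<comment> \<open>The first stage outside the cone; \<open>form_at_exit\<close> applies at the
      stage \<open>m\<close> just before it, which is at least \<open>N\<close>.\<close>
    define n where "n = (LEAST n. downs n (v k) \<notin> cone)"
    have n: "downs n (v k) \<notin> cone" unfolding n_def by (rule LeastI) fact
    then have "n > N" using elim(1) by (meson atMost_iff not_less)
    then obtain m where m: "n = Suc m" "m \<ge> N" by (cases n) auto
    have "downs m (v k) \<in> cone" using not_less_Least[of m] m(1) unfolding n_def by (metis lessI)
    then have "\<theta> m \<le> norm (form (U m) (Y m) (downs m (v k)))"
      using n by (intro form_at_exit downs_mem_E v(1)) (simp_all add: m)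
    also have "\<dots> = norm (form (U 0) (Y 0) (p, q))" by (simp add: form_downs pq)
    also have "\<dots> \<le> norm q * norm (p - U 0 * q) + (norm (p - U 0 * q))\<^sup>2 / \<rho>" by (rule form_bounds)
    also have "\<dots> \<le> \<kappa> - e + (norm (L k))\<^sup>2 / \<rho>" using v(3)[of k] by (simp add: pq L_def)
    also have "\<dots> < \<kappa> - e / 2" using elim(2) by linarith
    finally show ?case using N[OF m(2)] by simp
  qed
  then show False by simp
qed

text \<open>The images of \<open>(1, 0)\<close> are the required approximations: the form there is
  \<open>1 / (U (Suc n) - Y (Suc n))\<close>, and its modulus tends to
  \<open>1 / |\<xi> - \<eta>|\<close>.\<close>

lemma liminf_upper:
  assumes e: "e > 0"
  shows "\<exists>p q. (p, q) \<in> E \<and> Q \<le> norm q \<and> norm q * norm (p - U 0 * q) < \<kappa> + e"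
proof -
  \<comment> \<open>One \<open>up n\<close> is split off because \<open>(1, 0)\<close> is not in the
    cone but its image is.\<close>
  define V where "V = (\<lambda>n. ups n (up n (1, 0)))"
  define L where "L = (\<lambda>n. fst (V n) - U 0 * snd (V n))"
  define f where "f = (\<lambda>n. norm (form (U 0) (Y 0) (V n)))"
  have VE: "V n \<in> E" for n unfolding V_def by (intro ups_mem_E up_mem_E unit_vector_in_E)
  have co: "V n \<in> cone" and big: "2 ^ n \<le> norm (snd (V n))" for n
  proof -
    have "2 ^ n * 1 \<le> 2 ^ n * norm (snd (up n (1, 0)))" using unit_up_cone(2)[of n] by (intro mult_left_mono) auto
    then have "2 ^ n \<le> 2 ^ n * norm (snd (up n (1, 0)))" by simp
    also have "\<dots> \<le> norm (snd (V n))"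
      using ups_cone[OF unit_up_cone(1)[of n], of n] unfolding V_def by blast
    finally show "2 ^ n \<le> norm (snd (V n))" .
    show "V n \<in> cone" using ups_cone[OF unit_up_cone(1)[of n], of n] unfolding V_def by blast
  qed
  have lim: "filterlim (\<lambda>n. norm (snd (V n))) at_top sequentially"
  proof (rule filterlim_at_top_mono)
    show "filterlim (\<lambda>n. 2 ^ n :: real) at_top sequentially"
      using filterlim_realpow_sequentially_gt1[of "2::real"] filterlim_at_infinity_imp_filterlim_at_top
      by fastforce
  qed (use big in simp)
  have "U \<longlonglongrightarrow> \<xi>"
  proof (rule LIM_zero_cancel, rule Lim_null_comparison)
    show "eventually (\<lambda>n. norm (U n - \<xi>) \<le> 2 * \<delta> n) sequentially" using U_close by simp
    show "(\<lambda>n. 2 * \<delta> n) \<longlonglongrightarrow> 0" using tendsto_mult[OF tendsto_const \<delta>(4), of 2] by simp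
  qed
  moreover have "Y \<longlonglongrightarrow> \<eta>"
  proof (rule LIMSEQ_imp_Suc, rule LIM_zero_cancel, rule Lim_null_comparison)
    show "eventually (\<lambda>n. norm (Y (Suc n) - \<eta>) \<le> 2 * \<delta> n) sequentially" using Y_close[of "Suc _"] by simp
    show "(\<lambda>n. 2 * \<delta> n) \<longlonglongrightarrow> 0" using tendsto_mult[OF tendsto_const \<delta>(4), of 2] by simp
  qed
  ultimately have "(\<lambda>n. 1 / norm (U n - Y n)) \<longlonglongrightarrow> 1 / norm (\<xi> - \<eta>)"
    using \<rho> by (intro tendsto_intros) auto
  then have "(\<lambda>n. 1 / norm (U (Suc n) - Y (Suc n))) \<longlonglongrightarrow> \<kappa>"
    unfolding \<kappa> by (rule LIMSEQ_Suc)
  moreover have "f n = 1 / norm (U (Suc n) - Y (Suc n))" for n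
    unfolding f_def V_def form_ups form_up by (simp add: form_def norm_divide)
  ultimately have f: "f \<longlonglongrightarrow> \<kappa>" by presburger
  \<comment> \<open>In the cone the factor \<open>p - Y 0 * q\<close> has size at least
    \<open>\<rho> * 2 ^ n\<close>, so boundedness of the form makes the other factor small.\<close>
  have Lf: "norm (L n) \<le> f n * norm (U 0 - Y 0) / \<rho> / 2 ^ n" for n
  proof -
    obtain p q where pq: "V n = (p, q)" by (metis surj_pair)
    have "norm ((\<xi> - \<eta>) * q) \<le> norm (p - \<eta> * q) + norm (p - \<xi> * q)"
      using norm_triangle_ineq4[of "p - \<eta> * q" "p - \<xi> * q"] by (simp add: algebra_simps)
    moreover have "norm ((\<xi> - \<eta>) * q) \<ge> 4 * \<rho> * norm q"
      unfolding norm_mult using \<rho> by (intro mult_right_mono) auto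
    moreover have "norm (p - \<xi> * q) \<le> \<rho> * norm q" using co[of n] by (simp add: pq cone_def)
    moreover have "\<rho> * 2 ^ n \<le> \<rho> * norm q" using big[of n] \<rho> by (simp add: pq)
    moreover have "\<rho> * 2 ^ n > 0" using \<rho> by simp
    ultimately have "norm (p - Y 0 * q) \<ge> \<rho> * 2 ^ n" unfolding Y_0 by linarith
    then have "norm (L n) * (\<rho> * 2 ^ n) \<le> norm (L n) * norm (p - Y 0 * q)" by (intro mult_left_mono) auto
    also have "\<dots> = f n * norm (U 0 - Y 0)"
      using U_Y_dist[of 0] \<rho> by (auto simp: f_def L_def pq form_def norm_mult norm_divide)
    finally show ?thesis using \<rho> by (simp add: field_simps)
  qed
  have L: "L \<longlonglongrightarrow> 0"
  proof (rule Lim_null_comparison)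
    show "eventually (\<lambda>n. norm (L n) \<le> f n * norm (U 0 - Y 0) / \<rho> / 2 ^ n) sequentially" using Lf by simp
    have "(\<lambda>n. f n * norm (U 0 - Y 0) / \<rho> * (1 / 2) ^ n) \<longlonglongrightarrow> \<kappa> * norm (U 0 - Y 0) / \<rho> * 0"
      using \<rho> by (intro tendsto_intros f LIMSEQ_power_zero) auto
    then show "(\<lambda>n. f n * norm (U 0 - Y 0) / \<rho> / 2 ^ n) \<longlonglongrightarrow> 0" by (simp add: power_divide)
  qed
  have "(\<lambda>n. f n + (norm (L n))\<^sup>2 / \<rho>) \<longlonglongrightarrow> \<kappa> + (norm (0::complex))\<^sup>2 / \<rho>"
    using \<rho> by (intro tendsto_intros L f) auto
  then have "eventually (\<lambda>n. f n + (norm (L n))\<^sup>2 / \<rho> < \<kappa> + e) sequentially"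
    using e by (intro order_tendstoD) auto
  moreover have "eventually (\<lambda>n. Q \<le> norm (snd (V n))) sequentially"
    using lim by (simp add: filterlim_at_top)
  ultimately have "eventually (\<lambda>n. Q \<le> norm (snd (V n)) \<and> f n + (norm (L n))\<^sup>2 / \<rho> < \<kappa> + e) sequentially"
    by eventually_elim simp
  then obtain n where n: "Q \<le> norm (snd (V n))" "f n + (norm (L n))\<^sup>2 / \<rho> < \<kappa> + e"
    using eventually_happens'[OF sequentially_bot] by blast
  obtain p q where pq: "V n = (p, q)" by (metis surj_pair)
  show ?thesis
    using form_bounds(1)[of q p] n VE[of n] by (intro exI[of _ p] exI[of _ q]) (auto simp: pq f_def L_def)
qed

end

lemma (in return_sequence) gluing: "\<exists>x. x \<notin> fracs \<and> is_liminf x \<kappa>"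
proof -
  have D: "cball \<xi> \<rho> = {z. norm (z - \<xi>) \<le> \<rho>}" by (auto simp: dist_norm norm_minus_commute)
  have 1: "cball \<xi> \<rho> \<noteq> {}" using \<rho> by simp
  have 2: "continuous_on (cball \<xi> \<rho>) (mob n)" for n
    unfolding mob_def[abs_def] D using mob_denom by (intro continuous_intros) auto
  have 3: "mob n ` cball \<xi> \<rho> \<subseteq> cball \<xi> \<rho>" for n unfolding D using mob_near by blast
  have 4: "inv_mob n (mob n z) = z" if "z \<in> cball \<xi> \<rho>" for n z using that inv_mob_mob by (simp add: D)
  have "\<exists>U. (\<forall>n. U n \<in> cball \<xi> \<rho>) \<and> (\<forall>n. U n = mob n (U (Suc n)))"
    by (rule inverse_limit_point[of "cball \<xi> \<rho>" mob inv_mob, OF compact_cball 1 2 3 4])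
  then obtain U where U': "\<forall>n. U n \<in> cball \<xi> \<rho>" "\<forall>n. U n = mob n (U (Suc n))"
    by (elim exE conjE) (rule that)
  have U: "norm (U n - \<xi>) \<le> \<rho>" for n using spec[OF U'(1), of n] by (simp add: D)
  interpret return_orbit R I w \<xi> \<eta> \<rho> \<kappa> \<delta> a b c d x1 y1 x2 y2 U "rec_nat \<eta> inv_mob"
    proof unfold_locales
    show "U n = mob n (U (Suc n))" for n using U'(2) by (rule spec)
  qed (simp_all add: U)
  show ?thesis
    unfolding is_liminf_def using U_not_fracs liminf_lower liminf_upper by blast
qed

section \<open>Closedness of the set of lower limits\<close>

context quadratic_ideal
begin

text \<open>\<open>p = 1 + t * s\<close> is invertible modulo every power of \<open>t\<close>, the
  inverse being a finite geometric series, so it is coprime to \<open>q = t ^ k\<close>; this leaves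
  \<open>s\<close> free to place \<open>p / q\<close>.\<close>

lemma dense_approximations:
  assumes "\<epsilon> > 0"
  shows "\<exists>p q. (p, q) \<in> E \<and> N \<le> norm q \<and> 0 < norm q \<and> norm (z - p / q) < \<epsilon>"
proof -
  obtain u where u: "u \<in> I" "u \<noteq> 0" using I_nonzero by blast
  \<comment> \<open>Doubling gives norm at least 2, so the powers of \<open>t\<close> are unbounded
    even if \<open>u\<close> is a unit.\<close>
  define t where "t = u + u"
  have t: "t \<in> I" unfolding t_def using u(1) by (intro I_add)
  note tR = I_mem[OF t]
  have "norm t = 2 * norm u" using norm_mult[of 2 u] by (simp add: t_def)
  then have t2: "norm t \<ge> 2" using norm_ge_1[OF I_mem[OF u(1)] u(2)] by simp
  define B where "B = max N (norm t * cover_radius / \<epsilon>)"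
  obtain k0 where "B < norm t ^ k0" using real_arch_pow[of "norm t" B] t2 by auto
  moreover have "norm t ^ k0 \<le> norm t ^ Suc k0" using t2 by (intro power_increasing) auto
  ultimately have B: "B < norm t ^ Suc k0" by linarith
  define k where "k = Suc k0"
  define q where "q = t ^ k"
  have nq: "norm q = norm t ^ k" by (simp add: q_def norm_power)
  have nz: "t \<noteq> 0" "q \<noteq> 0" using t2 by (auto simp: q_def)
  \<comment> \<open>Rounds the solution of \<open>1 + t * s = z * q\<close>.\<close>
  obtain s where s: "s \<in> R" "norm ((z * q - 1) / t - s) \<le> cover_radius" using near_R by blast
  define p where "p = 1 + t * s"
  have "(\<Sum>i<m. (- (t * s)) ^ i) \<in> R" for m
    by (induction m) (use tR s in \<open>auto intro!: zero_mem add_mem power_mem uminus_mem mult_mem\<close>)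
  moreover have "(\<Sum>i<k. (- (t * s)) ^ i) * p + (- s) ^ k * q = 1"
  proof -
    have "1 - (- (t * s)) ^ k = (1 - - (t * s)) * (\<Sum>i<k. (- (t * s)) ^ i)" by (rule one_diff_power_eq)
    moreover have "(- (t * s)) ^ k = (- s) ^ k * q" by (simp add: q_def mult.commute flip: power_mult_distrib)
    ultimately have "(\<Sum>i<k. (- (t * s)) ^ i) * p = 1 - (- s) ^ k * q" by (simp add: p_def mult.commute)
    then show ?thesis by simp
  qed
  moreover have "p \<in> R" "(- s) ^ k \<in> R" using s tR by (auto simp: p_def intro!: R_closed power_mem)
  moreover have "q \<in> I" unfolding q_def k_def using t tR by (auto intro: I_mult2 power_mem)
  ultimately have "(p, q) \<in> E" unfolding E_def by blast
  moreover have "N \<le> norm q" using B by (simp add: nq B_def k_def)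
  moreover have "norm (z - p / q) < \<epsilon>"
  proof -
    have "z - p / q = t / q * ((z * q - 1) / t - s)" using nz by (simp add: p_def field_simps)
    then have "norm (z - p / q) = norm t / norm q * norm ((z * q - 1) / t - s)" by (simp add: norm_mult norm_divide)
    also have "\<dots> \<le> norm t / norm q * cover_radius" using s by (intro mult_left_mono) auto
    also have "\<dots> < \<epsilon>"
    proof -
      have "norm t * cover_radius / \<epsilon> < norm q" using B by (simp add: nq B_def k_def)
      then show ?thesis using assms nz by (simp add: field_simps)
    qed
    finally show ?thesis .
  qed
  ultimately show ?thesis using nz by auto
qed

text \<open>The pairs of the closing argument below would be at infinite distance for the value 0, which
  is therefore obtained separately, from the Baire category theorem.\<close>

lemma liminf_zero: "\<exists>x. x \<notin> fracs \<and> is_liminf x 0"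
proof -
  \<comment> \<open>Points having an approximation with \<open>|q| \<ge> n + 1\<close> and value
    below \<open>1 / (n + 1)\<close>; dense because it contains the centres of the balls. The
    countably many fractions are removed one by one, each complement being open and dense.\<close>
  define U where "U = (\<lambda>n::nat. \<Union>(p, q)\<in>{(p, q) \<in> E. real (Suc n) \<le> norm q}. ball (p / q) (1 / (real (Suc n) * (norm q)\<^sup>2)))"
  define G where "G = range U \<union> (\<lambda>k. - {k}) ` fracs"
  have "countable G" unfolding G_def using countable_fracs by auto
  moreover have "openin (top_of_set UNIV) T \<and> UNIV \<subseteq> closure T" if "T \<in> G" for T
  proof -
    consider n where "T = U n" | k where "T = - {k}" using \<open>T \<in> G\<close> unfolding G_def by blast
    then show ?thesis
    proof cases
      case 1
      have "open (U n)" unfolding U_def by (intro open_UN) auto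
      moreover have "z \<in> closure (U n)" for z
        unfolding closure_approachable
      proof (intro allI impI)
        fix e :: real assume "e > 0"
        then obtain p q where pq: "(p, q) \<in> E" "real (Suc n) \<le> norm q" "0 < norm q" "norm (z - p / q) < e"
          using dense_approximations by blast
        moreover have "p / q \<in> ball (p / q) (1 / (real (Suc n) * (norm q)\<^sup>2))" using pq(3) by simp
        ultimately have "p / q \<in> U n" unfolding U_def by blast
        then show "\<exists>y\<in>U n. dist y z < e" using pq(4) by (auto simp: dist_norm norm_minus_commute)
      qed
      ultimately show ?thesis using 1 by auto
    next
      case 2
      then show ?thesis by (simp add: open_Compl closure_complement)
    qed
  qed
  ultimately have "(UNIV :: complex set) \<subseteq> closure (\<Inter> G)" by (intro Baire) auto
  then have "\<Inter> G \<noteq> {}" by force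
  then obtain x where x: "x \<in> \<Inter> G" by blast
  have "x \<notin> fracs" using x by (auto simp: G_def)
  moreover have "\<exists>p q. (p, q) \<in> E \<and> Q \<le> norm q \<and> norm q * norm (p - x * q) < e" if "e > 0" for e Q :: real
  proof -
    obtain n where n: "max Q (1 / e) < real n" using reals_Archimedean2 by blast
    have "x \<in> U n" using x by (auto simp: G_def)
    then obtain p q where pq: "(p, q) \<in> E" "real (Suc n) \<le> norm q" "norm (p / q - x) < 1 / (real (Suc n) * (norm q)\<^sup>2)"
      unfolding U_def by (auto simp: dist_norm)
    have q: "norm q > 0" using pq(2) by linarith
    have "p - x * q = (p / q - x) * q" using q by (simp add: field_simps)
    then have "norm q * norm (p - x * q) = (norm q)\<^sup>2 * norm (p / q - x)"
      by (simp add: norm_mult power2_eq_square)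
    also have "\<dots> < (norm q)\<^sup>2 * (1 / (real (Suc n) * (norm q)\<^sup>2))" using pq(3) q by (intro mult_strict_left_mono) auto
    also have "\<dots> = 1 / real (Suc n)" using q by simp
    also have "\<dots> < e" using n that by (simp add: field_simps)
    finally show ?thesis using pq n by (intro exI[of _ p] exI[of _ q]) auto
  qed
  moreover have "0 - e < norm q * norm (p - x * q)" if "e > 0" for e :: real and p q
    using that mult_nonneg_nonneg[OF norm_ge_zero[of q] norm_ge_zero[of "p - x * q"]] by linarith
  ultimately show ?thesis unfolding is_liminf_def by (intro exI[of _ x]) auto
qed

section \<open>Visits of trajectories and return maps\<close>

definition is_matrix :: "complex \<Rightarrow> complex \<Rightarrow> complex \<Rightarrow> complex \<Rightarrow> bool" where
  "is_matrix a b c d \<longleftrightarrow> a \<in> R \<and> b \<in> R \<and> c \<in> I \<and> d \<in> R \<and> a * d - b * c = 1"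

text \<open>For \<open>g = (a, b; c, d)\<close> the two points are \<open>g^(-1) x\<close> and
  \<open>g^(-1) \<infinity>\<close>. Asking for \<open>|c| \<ge> Q\<close> with every
  \<open>Q\<close> makes the visits recur arbitrarily late.\<close>

definition visits :: "complex \<Rightarrow> complex \<Rightarrow> complex \<Rightarrow> real \<Rightarrow> bool" where
  "visits x \<xi> \<eta> \<delta> \<longleftrightarrow> (\<forall>Q. \<exists>a b c d. is_matrix a b c d \<and> Q \<le> norm c \<and>
     norm ((d * x - b) / (a - c * x) - \<xi>) \<le> \<delta> \<and> norm (- d / c - \<eta>) \<le> \<delta>)"

lemma matrix_denom: "x \<notin> fracs \<Longrightarrow> is_matrix a b c d \<Longrightarrow> a - c * x \<noteq> 0"
proof -
  assume x: "x \<notin> fracs" and m: "is_matrix a b c d"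
  have "a \<noteq> 0 \<or> c \<noteq> 0" using m by (auto simp: is_matrix_def)
  then have "a - x * c \<noteq> 0" using not_fracs_linear_nonzero[OF x] m by (auto simp: is_matrix_def I_mem)
  then show ?thesis by (simp add: mult.commute)
qed

text \<open>Links values with geometry: an approximation \<open>a / c\<close> with value near
  \<open>\<kappa>\<close> has end points at distance near \<open>1 / \<kappa>\<close>.\<close>

lemma endpoint_diff:
  assumes "a * d - b * c = 1" "a - c * x \<noteq> 0" "c \<noteq> (0::complex)"
  shows "(d * x - b) / (a - c * x) - (- d / c) = 1 / ((a - c * x) * c)"
proof -
  have "(d * x - b) / (a - c * x) - (- d / c) = ((d * x - b) * c + d * (a - c * x)) / ((a - c * x) * c)"
    using assms by (simp add: add_frac_eq)
  also have "(d * x - b) * c + d * (a - c * x) = a * d - b * c" by (simp add: algebra_simps)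
  finally show ?thesis by (simp add: assms)
qed

text \<open>The completion of an approximation to a matrix is free up to a translation on the right,
  which is used to bring \<open>g^(-1) x\<close> within \<open>cover_radius\<close> of 0. As
  \<open>\<kappa> > 0\<close>, the other end point is bounded too, and compactness gives the
  pair.\<close>

lemma limit_pair:
  assumes x: "x \<notin> fracs" and lim: "is_liminf x \<kappa>" and \<kappa>: "\<kappa> > 0"
  obtains \<xi> \<eta> where "norm \<xi> \<le> cover_radius" "norm (\<xi> - \<eta>) = 1 / \<kappa>" "\<And>\<delta>. \<delta> > 0 \<Longrightarrow> visits x \<xi> \<eta> \<delta>"
proof -
  have "\<exists>a b c d. is_matrix a b c d \<and> real (Suc k) \<le> norm c \<and> \<bar>norm ((a - c * x) * c) - \<kappa>\<bar> < 1 / real (Suc k) \<and>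
     norm ((d * x - b) / (a - c * x)) \<le> cover_radius" for k
  proof -
    have e: "1 / real (Suc k) > 0" by simp
    obtain Q where Q: "\<And>p q. (p, q) \<in> E \<Longrightarrow> Q \<le> norm q \<Longrightarrow> \<kappa> - 1 / real (Suc k) < norm q * norm (p - x * q)"
      using lim e unfolding is_liminf_def by meson
    obtain p q where pq: "(p, q) \<in> E" "max Q (real (Suc k)) \<le> norm q" "norm q * norm (p - x * q) < \<kappa> + 1 / real (Suc k)"
      using lim e unfolding is_liminf_def by meson
    obtain r s where rs: "r \<in> R" "s \<in> R" "r * p + s * q = 1" and mem: "p \<in> R" "q \<in> I" using pq(1) by (auto simp: E_def)
    have "is_matrix p (- s) q r" using rs mem by (auto simp: is_matrix_def uminus_mem mult.commute add.commute)
    then have nz: "p - q * x \<noteq> 0" using matrix_denom[OF x] by blast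
    obtain t where t: "t \<in> R" "norm ((r * x + s) / (p - q * x) - t) \<le> cover_radius" using near_R by blast
    \<comment> \<open>Product with \<open>(1, t; 0, 1)\<close> on the right, which replaces
      \<open>g^(-1) x\<close> by \<open>g^(-1) x - t\<close>.\<close>
    have m: "is_matrix p (- s + p * t) q (r + q * t)"
      using rs mem t by (auto simp: is_matrix_def algebra_simps intro!: R_closed simp: I_mem)
    have "((r + q * t) * x - (- s + p * t)) / (p - q * x) = ((r * x + s) - t * (p - q * x)) / (p - q * x)"
      by (simp add: algebra_simps)
    also have "\<dots> = (r * x + s) / (p - q * x) - t" using nz by (simp add: diff_divide_distrib)
    finally have "norm (((r + q * t) * x - (- s + p * t)) / (p - q * x)) \<le> cover_radius" using t by simp
    moreover have "\<bar>norm ((p - q * x) * q) - \<kappa>\<bar> < 1 / real (Suc k)"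
      using pq Q[OF pq(1)] by (simp add: norm_mult mult.commute abs_less_iff)
    moreover have "real (Suc k) \<le> norm q" using pq(2) by simp
    ultimately show ?thesis using m by blast
  qed
  then obtain a b c d where m: "\<And>k. is_matrix (a k) (b k) (c k) (d k)" and c: "\<And>k::nat. real (Suc k) \<le> norm (c k)"
    and near: "\<And>k. \<bar>norm ((a k - c k * x) * c k) - \<kappa>\<bar> < 1 / real (Suc k)"
    and bd: "\<And>k. norm ((d k * x - b k) / (a k - c k * x)) \<le> cover_radius" by metis
  define U where "U = (\<lambda>k. (d k * x - b k) / (a k - c k * x))"
  define V where "V = (\<lambda>k. - d k / c k)"
  have UV: "U k - V k = 1 / ((a k - c k * x) * c k)" for k
  proof -
    have "c k \<noteq> 0" using c[of k] by auto
    then show ?thesis using endpoint_diff[OF _ matrix_denom[OF x m]] m[of k] by (simp add: U_def V_def is_matrix_def)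
  qed
  have "(\<lambda>k. norm ((a k - c k * x) * c k) - \<kappa>) \<longlonglongrightarrow> 0"
  proof (rule Lim_null_comparison)
    show "eventually (\<lambda>k. norm (norm ((a k - c k * x) * c k) - \<kappa>) \<le> 1 / real (Suc k)) sequentially"
      using near by (simp add: less_imp_le)
    show "(\<lambda>k. 1 / real (Suc k)) \<longlonglongrightarrow> 0" using LIMSEQ_Suc[OF lim_const_over_n] .
  qed
  then have "(\<lambda>k. norm ((a k - c k * x) * c k)) \<longlonglongrightarrow> \<kappa>" by (rule LIM_zero_cancel)
  then have "(\<lambda>k. 1 / norm ((a k - c k * x) * c k)) \<longlonglongrightarrow> 1 / \<kappa>" using \<kappa> by (intro tendsto_intros) auto
  then have lim1: "(\<lambda>k. norm (U k - V k)) \<longlonglongrightarrow> 1 / \<kappa>" by (simp add: UV norm_divide)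
  then have "Bseq (\<lambda>k. norm (U k - V k))" by (rule convergent_imp_Bseq[OF convergentI])
  then obtain B where B: "\<And>k. norm (U k - V k) \<le> B" unfolding Bseq_def by auto
  have "norm (U k, V k) \<le> cover_radius + (cover_radius + B)" for k
  proof -
    have "norm (V k) \<le> norm (U k) + norm (U k - V k)" using norm_triangle_ineq4[of "U k" "U k - V k"] by simp
    then show ?thesis using bd[of k] B[of k] norm_Pair_le[of "U k" "V k"] by (simp add: U_def)
  qed
  then have "bounded (range (\<lambda>k. (U k, V k)))" by (auto simp: bounded_iff)
  then obtain l r where r: "strict_mono r" "((\<lambda>k. (U k, V k)) \<circ> r) \<longlonglongrightarrow> l"
    using bounded_imp_convergent_subsequence by blast
  obtain \<xi> \<eta> where l: "l = (\<xi>, \<eta>)" by (metis surj_pair)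
  have lU: "(\<lambda>k. U (r k)) \<longlonglongrightarrow> \<xi>" and lV: "(\<lambda>k. V (r k)) \<longlonglongrightarrow> \<eta>"
    using tendsto_fst[OF r(2)] tendsto_snd[OF r(2)] by (simp_all add: l o_def)
  show ?thesis
  proof (rule that)
    show "norm \<xi> \<le> cover_radius"
      using tendsto_norm[OF lU] by (rule LIMSEQ_le_const2) (use bd in \<open>auto simp: U_def\<close>)
    have "(\<lambda>k. norm (U (r k) - V (r k))) \<longlonglongrightarrow> norm (\<xi> - \<eta>)" by (intro tendsto_intros lU lV)
    moreover have "(\<lambda>k. norm (U (r k) - V (r k))) \<longlonglongrightarrow> 1 / \<kappa>"
      using LIMSEQ_subseq_LIMSEQ[OF lim1 r(1)] by (simp add: o_def)
    ultimately show "norm (\<xi> - \<eta>) = 1 / \<kappa>" by (rule LIMSEQ_unique)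
    fix \<delta> :: real assume \<delta>: "\<delta> > 0"
    show "visits x \<xi> \<eta> \<delta>"
      unfolding visits_def
    proof
      fix Q :: real
      have "eventually (\<lambda>k. norm (U (r k) - \<xi>) < \<delta>) sequentially" "eventually (\<lambda>k. norm (V (r k) - \<eta>) < \<delta>) sequentially"
        using tendstoD[OF lU \<delta>] tendstoD[OF lV \<delta>] by (simp_all add: dist_norm)
      moreover have "eventually (\<lambda>k. Q \<le> norm (c (r k))) sequentially"
        using eventually_ge_at_top[of "nat \<lceil>Q\<rceil>"]
      proof eventually_elim
        case (elim k)
        have "Q \<le> real k" using elim by linarith
        also have "\<dots> \<le> real (r k)" using seq_suble[OF r(1), of k] by simp
        also have "\<dots> \<le> norm (c (r k))" using c[of "r k"] by simp
        finally show ?case .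
      qed
      ultimately have "eventually (\<lambda>k. norm (U (r k) - \<xi>) < \<delta> \<and> norm (V (r k) - \<eta>) < \<delta> \<and> Q \<le> norm (c (r k))) sequentially"
        by eventually_elim simp
      then obtain k where "norm (U (r k) - \<xi>) < \<delta>" "norm (V (r k) - \<eta>) < \<delta>" "Q \<le> norm (c (r k))"
        using eventually_happens'[OF sequentially_bot] by blast
      then show "\<exists>a b c d. is_matrix a b c d \<and> Q \<le> norm c \<and>
         norm ((d * x - b) / (a - c * x) - \<xi>) \<le> \<delta> \<and> norm (- d / c - \<eta>) \<le> \<delta>"
        using m[of "r k"] by (intro exI[of _ "a (r k)"] exI[of _ "b (r k)"] exI[of _ "c (r k)"] exI[of _ "d (r k)"])
          (simp add: U_def V_def)
    qed
  qed
qed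

lemma visits_mono:
  assumes "visits x \<xi> \<eta> \<delta>" "norm (\<xi> - \<xi>') \<le> \<delta>'" "norm (\<eta> - \<eta>') \<le> \<delta>'"
  shows "visits x \<xi>' \<eta>' (\<delta> + \<delta>')"
  unfolding visits_def
proof
  fix Q
  obtain a b c d where *: "is_matrix a b c d" "Q \<le> norm c"
     "norm ((d * x - b) / (a - c * x) - \<xi>) \<le> \<delta>" "norm (- d / c - \<eta>) \<le> \<delta>"
    using assms(1) unfolding visits_def by blast
  have "norm ((d * x - b) / (a - c * x) - \<xi>') \<le> \<delta> + \<delta>'" "norm (- d / c - \<eta>') \<le> \<delta> + \<delta>'"
    using norm_triangle_ineq[of "(d * x - b) / (a - c * x) - \<xi>" "\<xi> - \<xi>'"]
      norm_triangle_ineq[of "- d / c - \<eta>" "\<eta> - \<eta>'"] * assms by simp_all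
  then show "\<exists>a b c d. is_matrix a b c d \<and> Q \<le> norm c \<and>
     norm ((d * x - b) / (a - c * x) - \<xi>') \<le> \<delta> + \<delta>' \<and> norm (- d / c - \<eta>') \<le> \<delta> + \<delta>'"
    using * by blast
qed

text \<open>The return map is \<open>g1^(-1) * g2\<close> for two visits \<open>g1\<close>, \<open>g2\<close> of the same trajectory, the
  second one much later than the first one.\<close>

lemma return_map_exists:
  assumes x: "x \<notin> fracs" and vis: "visits x \<xi> \<eta> \<delta>"
    and \<rho>: "0 < \<rho>" "4 * \<rho> \<le> norm (\<xi> - \<eta>)" and \<delta>: "0 < \<delta>" "16 * \<delta> \<le> \<rho>"
    and low: "\<And>p q. (p, q) \<in> E \<Longrightarrow> Q0 \<le> norm q \<Longrightarrow> \<kappa> - \<delta> \<le> norm q * norm (p - x * q)"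
  shows "\<exists>a b c d x1 y1 x2 y2. return_map R I w \<xi> \<eta> \<rho> \<kappa> \<delta> a b c d x1 y1 x2 y2"
proof -
  obtain a1 b1 c1 d1 where m1: "is_matrix a1 b1 c1 d1" and c1: "max 1 (Q0 / \<rho>) \<le> norm c1"
    and n1: "norm ((d1 * x - b1) / (a1 - c1 * x) - \<xi>) \<le> \<delta>" "norm (- d1 / c1 - \<eta>) \<le> \<delta>"
    using vis unfolding visits_def by meson
  define l1 where "l1 = a1 - c1 * x"
  have l1: "l1 \<noteq> 0" using matrix_denom[OF x m1] by (simp add: l1_def)
  \<comment> \<open>The summands serve, in turn, the expansion by 2, the contraction of differences
    up to \<open>2 * \<rho>\<close> below \<open>\<delta>\<close>, and the closeness of
    \<open>a / c\<close> to \<open>x1\<close>.\<close>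
  define J where "J = 2 + 2 * \<rho> / \<delta> + 2 / \<rho>"
  have J: "2 \<le> J" "2 * \<rho> / \<delta> \<le> J" "2 / \<rho> \<le> J" using \<rho> \<delta> by (auto simp: J_def)
  \<comment> \<open>Chosen after \<open>J\<close> and the first visit, so that
    \<open>l1 * c2\<close> dominates \<open>c1 * l2\<close>, which \<open>l2_small\<close>
    controls.\<close>
  obtain a2 b2 c2 d2 where m2: "is_matrix a2 b2 c2 d2"
    and c2: "max 1 ((J * (1 + 3 * \<rho>) + norm c1) / (\<rho> * norm l1)) \<le> norm c2"
    and n2: "norm ((d2 * x - b2) / (a2 - c2 * x) - \<xi>) \<le> \<delta>" "norm (- d2 / c2 - \<eta>) \<le> \<delta>"
    using vis unfolding visits_def by meson
  define l2 where "l2 = a2 - c2 * x"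
  have l2: "l2 \<noteq> 0" using matrix_denom[OF x m2] by (simp add: l2_def)
  have cnz: "c1 \<noteq> 0" "c2 \<noteq> 0" using c1 c2 by auto
  have c21: "1 \<le> norm c2" using c2 by simp
  have big: "J * (1 + 3 * \<rho>) + norm c1 \<le> \<rho> * norm l1 * norm c2"
  proof -
    have "(J * (1 + 3 * \<rho>) + norm c1) / (\<rho> * norm l1) \<le> norm c2" using c2 by simp
    then show ?thesis using \<rho> l1 by (simp add: pos_divide_le_eq mult.commute)
  qed
  define x1 where "x1 = (d1 * x - b1) / l1"
  define x2 where "x2 = (d2 * x - b2) / l2"
  define y1 where "y1 = - d1 / c1"
  define y2 where "y2 = - d2 / c2"
  have near: "norm (x1 - \<xi>) \<le> \<delta>" "norm (y1 - \<eta>) \<le> \<delta>" "norm (x2 - \<xi>) \<le> \<delta>" "norm (y2 - \<eta>) \<le> \<delta>"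
    using n1 n2 by (simp_all add: x1_def x2_def y1_def y2_def l1_def l2_def)
  have mem1: "a1 \<in> R" "b1 \<in> R" "c1 \<in> I" "d1 \<in> R" "a1 * d1 - b1 * c1 = 1" "c1 \<in> R"
    and mem2: "a2 \<in> R" "b2 \<in> R" "c2 \<in> I" "d2 \<in> R" "a2 * d2 - b2 * c2 = 1" "c2 \<in> R"
    using m1 m2 by (auto simp: is_matrix_def I_mem)
  define a where "a = d1 * a2 - b1 * c2"
  define b where "b = d1 * b2 - b1 * d2"
  define c where "c = a1 * c2 - c1 * a2"
  define d where "d = a1 * d2 - c1 * b2"
  have mem: "a \<in> R" "b \<in> R" "c \<in> I" "d \<in> R"
    unfolding a_def b_def c_def d_def using mem1 mem2
    by (auto intro!: diff_mem mult_mem I_diff I_mult[of a1 c2] I_mult2[of c1 a2])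
  have det: "a * d - b * c = 1"
  proof -
    have "a * d - b * c = (a1 * d1 - b1 * c1) * (a2 * d2 - b2 * c2)"
      by (simp add: a_def b_def c_def d_def algebra_simps)
    then show ?thesis by (simp add: mem1 mem2)
  qed
  have xy2: "x2 - y2 = 1 / (l2 * c2)" and xy1: "x1 - y1 = 1 / (l1 * c1)"
    using endpoint_diff[OF mem2(5) l2[unfolded l2_def] cnz(2)] endpoint_diff[OF mem1(5) l1[unfolded l1_def] cnz(1)]
    by (simp_all add: x1_def x2_def y1_def y2_def l1_def l2_def)
  have far: "3 * \<rho> \<le> norm (x2 - y2)"
    using norm_triangle_ineq[of "x2 - y2" "y2 - \<eta>"] norm_triangle_ineq4[of "x2 - \<eta>" "x2 - \<xi>"] near \<rho> \<delta> by simp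
  have l2_small: "norm l2 \<le> 1 / (3 * \<rho>)"
  proof -
    have "3 * \<rho> \<le> 1 / (norm l2 * norm c2)" using far by (simp add: xy2 norm_divide norm_mult)
    then have "3 * \<rho> * (norm l2 * norm c2) \<le> 1" using l2 cnz by (simp add: pos_le_divide_eq)
    moreover have "norm l2 * 1 \<le> norm l2 * norm c2" using c21 by (intro mult_left_mono) auto
    then have "3 * \<rho> * norm l2 \<le> 3 * \<rho> * (norm l2 * norm c2)" using \<rho> by simp
    ultimately have "3 * \<rho> * norm l2 \<le> 1" by linarith
    then show ?thesis using \<rho> by (simp add: field_simps)
  qed
  have cl: "norm c1 * norm l2 * (2 * \<rho>) \<le> norm c1"
  proof -
    have "norm l2 * (2 * \<rho>) \<le> 1 / (3 * \<rho>) * (2 * \<rho>)" using l2_small \<rho> by (intro mult_right_mono) auto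
    also have "\<dots> \<le> 1" using \<rho> by simp
    finally show ?thesis using mult_left_mono[of "norm l2 * (2 * \<rho>)" 1 "norm c1"] by (simp add: mult.assoc)
  qed
  \<comment> \<open>Up to sign, \<open>c * z + d\<close> and \<open>- c * z + a\<close> both have
    this shape, \<open>u\<close> and \<open>v\<close> being differences to end points:
    \<open>u\<close> stays away from 0 and \<open>v\<close> is bounded, so the dominating term
    decides.\<close>
  have estimate: "J \<le> norm (l1 * c2 * u - c1 * l2 * v)" if "2 * \<rho> \<le> norm u" "norm v \<le> 2 * \<rho>" for u v
  proof -
    have "norm (l1 * c2 * u) \<ge> norm (l1 * c2) * (2 * \<rho>)"
      using that(1) unfolding norm_mult[of "l1 * c2"] by (intro mult_left_mono) auto
    moreover have "norm (c1 * l2 * v) \<le> norm (c1 * l2) * (2 * \<rho>)"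
      using that(2) unfolding norm_mult[of "c1 * l2"] by (intro mult_left_mono) auto
    moreover have "norm (c1 * l2) * (2 * \<rho>) \<le> norm c1" using cl by (simp add: norm_mult)
    moreover have "norm (l1 * c2) * (2 * \<rho>) = 2 * (\<rho> * norm l1 * norm c2)" by (simp add: norm_mult)
    moreover have "norm (l1 * c2 * u - c1 * l2 * v) \<ge> norm (l1 * c2 * u) - norm (c1 * l2 * v)"
      by (rule norm_triangle_ineq2)
    moreover have "J * (1 + 3 * \<rho>) \<ge> J" using J \<rho> by simp
    moreover have "norm c1 \<ge> 0" by simp
    ultimately show ?thesis using big J by linarith
  qed
  have c_eq: "c = l1 * c2 - c1 * l2" by (simp add: c_def l1_def l2_def algebra_simps)
  have c_big: "J \<le> norm c"
  proof -
    define A where "A = \<rho> * norm (c1 * l2)"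
    define B where "B = \<rho> * norm (l1 * c2)"
    have "2 * A \<le> norm c1" using cl by (simp add: A_def norm_mult mult_ac)
    moreover have "B - A \<le> \<rho> * norm c"
      unfolding c_eq A_def B_def right_diff_distrib[symmetric]
      using \<rho> norm_triangle_ineq2[of "l1 * c2" "c1 * l2"] by (intro mult_left_mono) auto
    moreover have "A \<ge> 0" using \<rho> by (simp add: A_def)
    moreover have "J + 3 * (\<rho> * J) + norm c1 \<le> B" using big by (simp add: B_def norm_mult algebra_simps)
    moreover have "\<rho> * J \<ge> 0" using \<rho> J by simp
    ultimately have "\<rho> * J \<le> \<rho> * norm c" using J(1) by linarith
    then show ?thesis using \<rho> by simp
  qed
  have j_eq: "c * z + d = l1 * c2 * (z - y2) - c1 * l2 * (z - x2)" for z
  proof -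
    have e: "c2 * y2 = - d2" "l2 * x2 = d2 * x - b2" using cnz l2 by (simp_all add: y2_def x2_def)
    have "l1 * c2 * (z - y2) - c1 * l2 * (z - x2) = c * z - l1 * (c2 * y2) + c1 * (l2 * x2)"
      by (simp add: c_eq algebra_simps)
    also have "\<dots> = c * z + d" unfolding e by (simp add: d_def l1_def algebra_simps)
    finally show ?thesis by (rule sym)
  qed
  have j'_eq: "- c * z + a = - (l1 * c2 * (z - x1) - c1 * l2 * (z - y1))" for z
  proof -
    have e: "c1 * y1 = - d1" "l1 * x1 = d1 * x - b1" using cnz l1 by (simp_all add: y1_def x1_def)
    have "- (l1 * c2 * (z - x1) - c1 * l2 * (z - y1)) = - c * z + c2 * (l1 * x1) - l2 * (c1 * y1)"
      by (simp add: c_eq algebra_simps)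
    also have "\<dots> = - c * z + a" unfolding e by (simp add: a_def l2_def algebra_simps)
    finally show ?thesis by (rule sym)
  qed
  have j: "J \<le> norm (c * z + d)" if "norm (z - \<xi>) \<le> \<rho>" for z
    unfolding j_eq
  proof (rule estimate)
    show "2 * \<rho> \<le> norm (z - y2)"
      using norm_triangle_ineq[of "z - y2" "y2 - \<eta>"] norm_triangle_ineq4[of "z - \<eta>" "z - \<xi>"] near \<rho> \<delta> that by simp
    show "norm (z - x2) \<le> 2 * \<rho>"
      using norm_triangle_ineq4[of "z - \<xi>" "x2 - \<xi>"] near \<rho> \<delta> that by simp
  qed
  have j': "J \<le> norm (- c * z + a)" if "norm (z - \<eta>) \<le> \<rho>" for z
    unfolding j'_eq norm_minus_cancel
  proof (rule estimate)
    show "2 * \<rho> \<le> norm (z - x1)"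
      using norm_triangle_ineq[of "z - x1" "x1 - \<xi>"] norm_triangle_ineq4[of "z - \<xi>" "z - \<eta>"] near \<rho> \<delta> that
      by (simp add: norm_minus_commute[of \<eta> \<xi>])
    show "norm (z - y1) \<le> 2 * \<rho>"
      using norm_triangle_ineq4[of "z - \<eta>" "y1 - \<eta>"] near \<rho> \<delta> that by simp
  qed
  have x2_in: "norm (x2 - \<xi>) \<le> \<rho>" and y1_in: "norm (y1 - \<eta>) \<le> \<rho>" using near \<rho> \<delta> by linarith+
  have jx2: "c * x2 + d \<noteq> 0" using j[OF x2_in] J by auto
  have jy1: "- c * y1 + a \<noteq> 0" using j'[OF y1_in] J by auto
  have map_x: "x1 = (a * x2 + b) / (c * x2 + d)"
  proof -
    have 1: "a2 * (d2 * x - b2) + b2 * l2 = (a2 * d2 - b2 * c2) * x"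
      "c2 * (d2 * x - b2) + d2 * l2 = a2 * d2 - b2 * c2" by (simp_all add: l2_def algebra_simps)
    have 2: "a2 * x2 + b2 = x / l2" "c2 * x2 + d2 = 1 / l2"
      using 1 l2 mem2(5) by (simp_all add: x2_def field_simps)
    have "a * x2 + b = d1 * (a2 * x2 + b2) - b1 * (c2 * x2 + d2)" by (simp add: a_def b_def algebra_simps)
    then have "a * x2 + b = (d1 * x - b1) / l2" unfolding 2 by (simp add: diff_divide_distrib)
    moreover have "c * x2 + d = a1 * (c2 * x2 + d2) - c1 * (a2 * x2 + b2)" by (simp add: c_def d_def algebra_simps)
    then have "c * x2 + d = l1 / l2" unfolding 2 by (simp add: diff_divide_distrib l1_def)
    ultimately show ?thesis using l2 by (simp add: x1_def)
  qed
  have map_y: "y2 = (d * y1 - b) / (- c * y1 + a)"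
  proof -
    have e: "c1 * y1 = - d1" using cnz by (simp add: y1_def)
    have "c1 * (d * y1 - b) = d * (c1 * y1) - c1 * b" by (simp add: algebra_simps)
    also have "\<dots> = - d2 * (a1 * d1 - b1 * c1)" unfolding e by (simp add: d_def b_def algebra_simps)
    finally have 1: "c1 * (d * y1 - b) = - d2" by (simp add: mem1)
    have "c1 * (- c * y1 + a) = - c * (c1 * y1) + c1 * a" by (simp add: algebra_simps)
    also have "\<dots> = c2 * (a1 * d1 - b1 * c1)" unfolding e by (simp add: a_def c_def algebra_simps)
    finally have 2: "c1 * (- c * y1 + a) = c2" by (simp add: mem1)
    have "(d * y1 - b) / (- c * y1 + a) = (c1 * (d * y1 - b)) / (c1 * (- c * y1 + a))" using cnz by simp
    then show ?thesis unfolding 1 2 by (simp add: y2_def)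
  qed
  have quot: "norm (u / (s * t)) \<le> \<delta>" if "norm u \<le> 2 * \<rho>" "J \<le> norm s" "J \<le> norm t" for u s t :: complex
  proof -
    have "norm (u / (s * t)) = norm u / (norm s * norm t)" by (simp add: norm_divide norm_mult)
    also have "\<dots> \<le> 2 * \<rho> / (J * 1)" using that J \<rho> by (intro frac_le mult_mono) auto
    also have "\<dots> \<le> \<delta>" using J \<delta> \<rho> by (simp add: field_simps)
    finally show ?thesis .
  qed
  show ?thesis
  proof (intro exI)
    show "return_map R I w \<xi> \<eta> \<rho> \<kappa> \<delta> a b c d x1 y1 x2 y2"
    proof unfold_locales
      fix z assume z: "norm (z - \<xi>) \<le> \<rho>"
      show "2 \<le> norm (c * z + d)" using j[OF z] J by linarith
      then have jz: "c * z + d \<noteq> 0" by auto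
      have "(a * z + b) / (c * z + d) - x1 = (z - x2) / ((c * z + d) * (c * x2 + d))"
        unfolding map_x by (rule mobius_diff[OF det jz jx2])
      moreover have "norm (z - x2) \<le> 2 * \<rho>"
        using norm_triangle_ineq4[of "z - \<xi>" "x2 - \<xi>"] near \<rho> \<delta> z by simp
      ultimately have "norm ((a * z + b) / (c * z + d) - x1) \<le> \<delta>" using quot j[OF z] j[OF x2_in] by simp
      then show "norm ((a * z + b) / (c * z + d) - \<xi>) \<le> 2 * \<delta>"
        using norm_triangle_ineq[of "(a * z + b) / (c * z + d) - x1" "x1 - \<xi>"] near by simp
    next
      fix z assume z: "norm (z - \<eta>) \<le> \<rho>"
      show jz: "- c * z + a \<noteq> 0" using j'[OF z] J by auto
      have det': "d * a - (- b) * (- c) = 1" using det by (simp add: algebra_simps)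
      have "(d * z - b) / (- c * z + a) - y2 = (z - y1) / ((- c * z + a) * (- c * y1 + a))"
        unfolding map_y using mobius_diff[OF det' jz jy1] by simp
      moreover have "norm (z - y1) \<le> 2 * \<rho>"
        using norm_triangle_ineq4[of "z - \<eta>" "y1 - \<eta>"] near \<rho> \<delta> z by simp
      ultimately have "norm ((d * z - b) / (- c * z + a) - y2) \<le> \<delta>"
        using quot[of "z - y1" "- c * z + a" "- c * y1 + a"] j'[OF z] j'[OF y1_in] by presburger
      then show "norm ((d * z - b) / (- c * z + a) - \<eta>) \<le> 2 * \<delta>"
        using norm_triangle_ineq[of "(d * z - b) / (- c * z + a) - y2" "y2 - \<eta>"] near by simp
    next
      show "2 \<le> norm c" using c_big J by linarith
      have "a - x1 * c = 1 / (c * x2 + d)"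
        using mobius_inverse(1)[OF det jx2] unfolding map_x[symmetric] by (simp add: mult.commute)
      then have "norm (a - x1 * c) \<le> 1 / J" using j[OF x2_in] J by (simp add: norm_divide frac_le)
      also have "\<dots> \<le> \<rho> / 2" using J \<rho> by (simp add: field_simps)
      also have "\<dots> \<le> \<rho> / 2 * norm c" using mult_left_mono[of 1 "norm c" "\<rho> / 2"] c_big J \<rho> by simp
      finally have "norm (a - x1 * c) \<le> \<rho> / 2 * norm c" .
      moreover have "norm ((x1 - \<xi>) * c) \<le> \<rho> / 2 * norm c"
        unfolding norm_mult using near \<rho> \<delta> by (intro mult_right_mono) auto
      ultimately show "norm (a - \<xi> * c) \<le> \<rho> * norm c"
        using norm_triangle_ineq[of "a - x1 * c" "(x1 - \<xi>) * c"] by (simp add: algebra_simps)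
    next
      fix p q assume pq: "(p, q) \<in> E" "norm (p - \<xi> * q) \<le> \<rho> * norm q"
      have "q \<noteq> 0" using pq E_nonzero by force
      then have q1: "1 \<le> norm q" using norm_ge_1 E_mem[OF pq(1)] I_mem by blast
      have "norm ((\<xi> - y1) * q) \<le> norm (p - y1 * q) + norm (p - \<xi> * q)"
        using norm_triangle_ineq4[of "p - y1 * q" "p - \<xi> * q"] by (simp add: algebra_simps)
      moreover have "norm (\<xi> - y1) \<ge> 3 * \<rho>"
        using norm_triangle_ineq[of "\<xi> - y1" "y1 - \<eta>"] near \<rho> \<delta> by simp
      then have "norm ((\<xi> - y1) * q) \<ge> 3 * \<rho> * norm q" unfolding norm_mult by (intro mult_right_mono) auto
      moreover have "\<rho> * norm q \<ge> \<rho>" using q1 \<rho> by simp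
      ultimately have Ly: "norm (p - y1 * q) \<ge> \<rho>" using pq(2) \<rho> by linarith
      \<comment> \<open>The second coordinate after applying the first matrix; the choice of
        \<open>c1\<close> makes it at least \<open>Q0\<close>, so \<open>low\<close> applies to the
        image of \<open>(p, q)\<close>.\<close>
      have q': "c1 * p + d1 * q = c1 * (p - y1 * q)" using cnz by (simp add: y1_def distrib_left)
      have "norm c1 * \<rho> \<le> norm (c1 * p + d1 * q)"
        unfolding q' norm_mult using Ly by (intro mult_left_mono) auto
      moreover have "Q0 \<le> norm c1 * \<rho>" using c1 \<rho> by (simp add: pos_divide_le_eq)
      ultimately have "\<kappa> - \<delta> \<le> norm (c1 * p + d1 * q) * norm ((a1 * p + b1 * q) - x * (c1 * p + d1 * q))"
        using E_act[OF pq(1) mem1(1-5)] by (intro low) auto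
      also have "(a1 * p + b1 * q) - x * (c1 * p + d1 * q) = l1 * (p - x1 * q)"
      proof -
        have "l1 * x1 = d1 * x - b1" using l1 by (simp add: x1_def)
        then have "l1 * (p - x1 * q) = l1 * p - (d1 * x - b1) * q" by (simp add: right_diff_distrib flip: mult.assoc)
        then show ?thesis by (simp add: l1_def algebra_simps)
      qed
      \<comment> \<open>As \<open>x1 - y1 = 1 / (l1 * c1)\<close>, the form with roots
        \<open>x1\<close>, \<open>y1\<close> is exactly the product for \<open>x\<close> transported
        by the first matrix, without error term.\<close>
      also have "norm (c1 * p + d1 * q) * norm (l1 * (p - x1 * q)) = norm (form x1 y1 (p, q))"
        using cnz l1 by (simp add: form_def xy1 q' norm_mult norm_divide)
      finally show "\<kappa> - \<delta> \<le> norm (form x1 y1 (p, q))" .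
    qed (fact mem det near map_x map_y)+
  qed
qed

text \<open>Values above \<open>\<kappa> / 2\<close> keep the pairs of the approximating points
  bounded, so a subsequence converges to a pair at distance \<open>1 / \<kappa>\<close>. For each
  accuracy \<open>\<delta> n\<close> one of these points supplies the matrix of stage
  \<open>n\<close>.\<close>

lemma liminf_closed_pos:
  assumes \<kappa>: "\<kappa> > 0" and cl: "\<And>e. e > 0 \<Longrightarrow> \<exists>x k. x \<notin> fracs \<and> is_liminf x k \<and> \<bar>k - \<kappa>\<bar> < e"
  shows "\<exists>x. x \<notin> fracs \<and> is_liminf x \<kappa>"
proof -
  have "\<exists>x k \<xi> \<eta>. x \<notin> fracs \<and> is_liminf x k \<and> \<bar>k - \<kappa>\<bar> < 1 / real (Suc n) \<and> \<bar>k - \<kappa>\<bar> < \<kappa> / 2 \<and>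
    norm \<xi> \<le> cover_radius \<and> norm (\<xi> - \<eta>) = 1 / k \<and> (\<forall>\<delta>>0. visits x \<xi> \<eta> \<delta>)" for n
  proof -
    obtain x k where xk: "x \<notin> fracs" "is_liminf x k" "\<bar>k - \<kappa>\<bar> < min (1 / real (Suc n)) (\<kappa> / 2)"
      using cl[of "min (1 / real (Suc n)) (\<kappa> / 2)"] \<kappa> by auto
    then have "k > 0" by linarith
    then obtain \<xi> \<eta> where "norm \<xi> \<le> cover_radius" "norm (\<xi> - \<eta>) = 1 / k" "\<And>\<delta>. \<delta> > 0 \<Longrightarrow> visits x \<xi> \<eta> \<delta>"
      using limit_pair[OF xk(1,2)] by blast
    then show ?thesis using xk by (intro exI[of _ x] exI[of _ k] exI[of _ \<xi>] exI[of _ \<eta>]) simp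
  qed
  then obtain x k u v where x: "\<And>n. x n \<notin> fracs" and lim: "\<And>n. is_liminf (x n) (k n)"
    and k1: "\<And>n::nat. \<bar>k n - \<kappa>\<bar> < 1 / real (Suc n)" and k2: "\<And>n. \<bar>k n - \<kappa>\<bar> < \<kappa> / 2"
    and u: "\<And>n. norm (u n) \<le> cover_radius" and uv: "\<And>n. norm (u n - v n) = 1 / k n"
    and vis: "\<And>n \<delta>. \<delta> > 0 \<Longrightarrow> visits (x n) (u n) (v n) \<delta>" by metis
  have "norm (u n, v n) \<le> cover_radius + (cover_radius + 2 / \<kappa>)" for n
  proof -
    have "\<kappa> / 2 \<le> k n" using k2[of n] by linarith
    then have "1 / k n \<le> 1 / (\<kappa> / 2)" using \<kappa> by (intro divide_left_mono) auto
    moreover have "norm (v n) \<le> norm (u n) + norm (u n - v n)" using norm_triangle_ineq4[of "u n" "u n - v n"] by simp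
    ultimately show ?thesis using u[of n] uv[of n] norm_Pair_le[of "u n" "v n"] by simp
  qed
  then have "bounded (range (\<lambda>n. (u n, v n)))" by (auto simp: bounded_iff)
  then obtain l r where r: "strict_mono r" "((\<lambda>n. (u n, v n)) \<circ> r) \<longlonglongrightarrow> l"
    using bounded_imp_convergent_subsequence by blast
  obtain \<xi> \<eta> where l: "l = (\<xi>, \<eta>)" by (metis surj_pair)
  have lu: "(\<lambda>n. u (r n)) \<longlonglongrightarrow> \<xi>" and lv: "(\<lambda>n. v (r n)) \<longlonglongrightarrow> \<eta>"
    using tendsto_fst[OF r(2)] tendsto_snd[OF r(2)] by (simp_all add: l o_def)
  have "(\<lambda>n. k n - \<kappa>) \<longlonglongrightarrow> 0"
  proof (rule Lim_null_comparison)
    show "eventually (\<lambda>n. norm (k n - \<kappa>) \<le> 1 / real (Suc n)) sequentially" using k1 by (simp add: less_imp_le)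
    show "(\<lambda>n. 1 / real (Suc n)) \<longlonglongrightarrow> 0" using LIMSEQ_Suc[OF lim_const_over_n] .
  qed
  then have "k \<longlonglongrightarrow> \<kappa>" by (rule LIM_zero_cancel)
  then have lk: "(\<lambda>n. k (r n)) \<longlonglongrightarrow> \<kappa>" using LIMSEQ_subseq_LIMSEQ[OF _ r(1)] by (simp add: o_def)
  have "(\<lambda>n. 1 / k (r n)) \<longlonglongrightarrow> 1 / \<kappa>" using \<kappa> lk by (intro tendsto_intros) auto
  moreover have "(\<lambda>n. norm (u (r n) - v (r n))) \<longlonglongrightarrow> norm (\<xi> - \<eta>)" by (intro tendsto_intros lu lv)
  ultimately have \<xi>\<eta>: "norm (\<xi> - \<eta>) = 1 / \<kappa>" using LIMSEQ_unique by (simp add: uv)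
  define \<rho> where "\<rho> = norm (\<xi> - \<eta>) / 4"
  have \<rho>: "0 < \<rho>" "4 * \<rho> \<le> norm (\<xi> - \<eta>)" using \<kappa> by (simp_all add: \<rho>_def \<xi>\<eta>)
  define \<delta> where "\<delta> = (\<lambda>n. \<rho> / 16 / real (Suc n))"
  have \<delta>: "0 < \<delta> n" "16 * \<delta> n \<le> \<rho>" for n using \<rho> by (simp_all add: \<delta>_def field_simps)
  have "\<exists>a b c d x1 y1 x2 y2. return_map R I w \<xi> \<eta> \<rho> \<kappa> (\<delta> n) a b c d x1 y1 x2 y2" for n
  proof -
    \<comment> \<open>Half of the accuracy is spent on the visit and half on the distance of the
      pairs; likewise for the lower limit and \<open>|k - \<kappa>|\<close>.\<close>
    define h where "h = \<delta> n / 2"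
    have h: "h > 0" "h + h = \<delta> n" using \<delta>(1)[of n] by (simp_all add: h_def)
    have "eventually (\<lambda>n. dist (u (r n)) \<xi> < h \<and> dist (v (r n)) \<eta> < h \<and> dist (k (r n)) \<kappa> < h) sequentially"
      using tendstoD[OF lu h(1)] tendstoD[OF lv h(1)] tendstoD[OF lk h(1)] by eventually_elim simp
    then obtain i where i: "norm (u (r i) - \<xi>) < h" "norm (v (r i) - \<eta>) < h" "\<bar>k (r i) - \<kappa>\<bar> < h"
      using eventually_happens'[OF sequentially_bot] unfolding dist_norm real_norm_def by blast
    have "visits (x (r i)) \<xi> \<eta> (\<delta> n)"
      using visits_mono[OF vis[OF h(1)], of "r i" \<xi> h \<eta>] i h(2) by simp
    moreover obtain Q where Q: "\<And>p q. (p, q) \<in> E \<Longrightarrow> Q \<le> norm q \<Longrightarrow> k (r i) - h < norm q * norm (p - x (r i) * q)"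
      using lim[of "r i"] h(1) unfolding is_liminf_def by meson
    have "\<kappa> - \<delta> n \<le> norm q * norm (p - x (r i) * q)" if "(p, q) \<in> E" "Q \<le> norm q" for p q
      using Q[OF that] i(3) h(2) by linarith
    ultimately show ?thesis using return_map_exists[OF x _ \<rho> \<delta>, of "r i" n Q \<kappa>] by blast
  qed
  then obtain a b c d x1 y1 x2 y2
    where ret: "\<And>n. return_map R I w \<xi> \<eta> \<rho> \<kappa> (\<delta> n) (a n) (b n) (c n) (d n) (x1 n) (y1 n) (x2 n) (y2 n)"
    by metis
  interpret return_sequence R I w \<xi> \<eta> \<rho> \<kappa> \<delta> a b c d x1 y1 x2 y2
  proof (rule return_sequence.intro, rule quadratic_ideal_axioms, rule return_sequence_axioms.intro)
    show "antimono \<delta>" using \<rho> by (auto simp: \<delta>_def antimono_def intro!: divide_left_mono)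
    show "\<delta> \<longlonglongrightarrow> 0" unfolding \<delta>_def using LIMSEQ_Suc[OF lim_const_over_n, of "\<rho> / 16"] by simp
    show "\<kappa> = 1 / norm (\<xi> - \<eta>)" by (simp add: \<xi>\<eta>)
  qed (fact ret \<rho> \<delta>)+
  show ?thesis by (rule gluing)
qed

section \<open>Closedness and finiteness of the lower limits\<close>

lemma is_liminf_nonneg:
  assumes "is_liminf x k" shows "k \<ge> 0"
proof (rule field_le_epsilon)
  fix e :: real assume "e > 0"
  then obtain p q where "norm q * norm (p - x * q) < k + e" using assms unfolding is_liminf_def by meson
  moreover have "0 \<le> norm q * norm (p - x * q)" by simp
  ultimately show "0 \<le> k + e" by linarith
qed

lemma closed_liminf: "closed {k. \<exists>x. x \<notin> fracs \<and> is_liminf x k}"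
  unfolding closed_limpt
proof (intro allI impI)
  let ?S = "{k. \<exists>x. x \<notin> fracs \<and> is_liminf x k}"
  fix \<kappa> assume "\<kappa> islimpt ?S"
  then have cl: "\<exists>x k. x \<notin> fracs \<and> is_liminf x k \<and> \<bar>k - \<kappa>\<bar> < e" if "e > 0" for e
    using that unfolding islimpt_approachable dist_real_def by blast
  have "\<kappa> \<ge> 0"
  proof (rule ccontr)
    assume "\<not> \<kappa> \<ge> 0"
    then obtain x k where "is_liminf x k" "\<bar>k - \<kappa>\<bar> < - \<kappa>" using cl[of "- \<kappa>"] by auto
    then show False using is_liminf_nonneg[of x k] by linarith
  qed
  then show "\<kappa> \<in> ?S" using liminf_zero liminf_closed_pos[OF _ cl] by (cases "\<kappa> = 0") auto
qed

text \<open>The infima over \<open>|q| \<ge> T\<close> lie between 0 and the bound of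
  \<open>coprime_approximations\<close>, so their supremum is a real number.\<close>

lemma liminf_exists:
  assumes "x \<notin> fracs"
  shows "\<exists>k. is_liminf x k"
proof -
  define h where "h = (\<lambda>(p, q). norm q * norm (p - x * q))"
  define S where "S = (\<lambda>T. {v \<in> E. T \<le> norm (snd v)})"
  obtain K where K: "\<And>T. \<exists>p q. (p, q) \<in> E \<and> T \<le> norm q \<and> norm q * norm (p - x * q) \<le> K"
    using coprime_approximations[OF assms] by blast
  have h0: "0 \<le> h v" for v by (cases v) (simp add: h_def)
  have ne: "\<exists>v\<in>S T. h v \<le> K" for T using K[of T] by (force simp: S_def h_def)
  have bb: "bdd_below (h ` S T)" for T using h0 by (intro bdd_belowI[of _ 0]) auto
  define m where "m = (\<lambda>T. Inf (h ` S T))"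
  have mK: "m T \<le> K" for T
  proof -
    obtain v where "v \<in> S T" "h v \<le> K" using ne by blast
    then show ?thesis unfolding m_def using cInf_lower[OF _ bb, of "h v" T] by force
  qed
  have ba: "bdd_above (range m)" using mK by (intro bdd_aboveI[of _ K]) auto
  define k where "k = Sup (range m)"
  have "is_liminf x k"
    unfolding is_liminf_def
  proof (intro conjI allI impI)
    fix e :: real assume e: "e > 0"
    have "k - e < Sup (range m)" using e by (simp add: k_def)
    then obtain T where T: "k - e < m T" using less_cSup_iff[OF _ ba, of "k - e"] by auto
    have "k - e < norm q * norm (p - x * q)" if "(p, q) \<in> E" "T \<le> norm q" for p q
    proof -
      have "(p, q) \<in> S T" using that by (simp add: S_def)
      then have "m T \<le> h (p, q)" unfolding m_def using cInf_lower[OF _ bb] by blast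
      then show ?thesis using T by (simp add: h_def)
    qed
    then show "\<exists>Q. \<forall>p q. (p, q) \<in> E \<longrightarrow> Q \<le> norm q \<longrightarrow> k - e < norm q * norm (p - x * q)" by blast
  next
    fix e Q :: real assume e: "e > 0"
    have "m Q \<le> k" unfolding k_def using ba by (intro cSup_upper) auto
    then have "Inf (h ` S Q) < k + e" using e by (simp add: m_def)
    moreover have "h ` S Q \<noteq> {}" using ne[of Q] by blast
    ultimately obtain v where "v \<in> S Q" "h v < k + e" using cInf_less_iff[OF _ bb, of Q "k + e"] by auto
    then show "\<exists>p q. (p, q) \<in> E \<and> Q \<le> norm q \<and> norm q * norm (p - x * q) < k + e"
      by (intro exI[of _ "fst v"] exI[of _ "snd v"]) (auto simp: S_def h_def case_prod_unfold)
  qed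
  then show ?thesis ..
qed

end

section \<open>Orders in imaginary quadratic fields\<close>

lemma ring_on_simps:
  "carrier (ring_on R) = R" "\<zero>\<^bsub>ring_on R\<^esub> = 0" "\<one>\<^bsub>ring_on R\<^esub> = 1"
  "x \<otimes>\<^bsub>ring_on R\<^esub> y = x * y" "x \<oplus>\<^bsub>ring_on R\<^esub> y = x + y"
  by (simp_all add: ring_of_type_algebra_def)

lemma complex_ring_simps:
  "carrier complex_ring = UNIV" "\<zero>\<^bsub>complex_ring\<^esub> = 0" "\<one>\<^bsub>complex_ring\<^esub> = 1"
  "x \<otimes>\<^bsub>complex_ring\<^esub> y = x * y" "x \<oplus>\<^bsub>complex_ring\<^esub> y = x + y"
  by (simp_all add: ring_of_type_algebra_def)

lemma complex_ring_a_inv: "\<ominus>\<^bsub>complex_ring\<^esub> x = - x"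
proof -
  interpret cring complex_ring by (rule cring_from_type_algebra)
  have "- x \<oplus>\<^bsub>complex_ring\<^esub> x = \<zero>\<^bsub>complex_ring\<^esub>" by (simp add: complex_ring_simps)
  then show ?thesis by (intro minus_equality) (auto simp: complex_ring_simps)
qed

lemma complex_ring_m_inv: "x \<noteq> 0 \<Longrightarrow> inv\<^bsub>complex_ring\<^esub> x = inverse x"
proof -
  interpret cring complex_ring by (rule cring_from_type_algebra)
  assume "x \<noteq> 0"
  then show ?thesis by (intro comm_inv_char) (auto simp: complex_ring_simps)
qed

text \<open>Induction over the generated field; inversion divides by the norm
  \<open>u\<^sup>2 + v\<^sup>2 * m\<close>, which is rational.\<close>

lemma imag_quadratic_field_coords:
  assumes m: "m > 0" and z: "z \<in> imag_quadratic_field m"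
  shows "Re z \<in> \<rat> \<and> Im z / sqrt m \<in> \<rat>"
  using z unfolding imag_quadratic_field_def
proof (induction rule: generate_field.induct)
  case (m_inv h)
  define u v where "u = Re h" and "v = Im h / sqrt m"
  have uv: "u \<in> \<rat>" "v \<in> \<rat>" using m_inv.IH by (auto simp: u_def v_def)
  have "(Re h)\<^sup>2 + (Im h)\<^sup>2 = u\<^sup>2 + v\<^sup>2 * m" using m by (simp add: u_def v_def power_divide)
  moreover have "u\<^sup>2 + v\<^sup>2 * m \<in> \<rat>" using uv by (intro Rats_add Rats_mult Rats_power) auto
  ultimately have N: "(Re h)\<^sup>2 + (Im h)\<^sup>2 \<in> \<rat>" by simp
  have "h \<noteq> 0" using m_inv.hyps(2) by (simp add: complex_ring_simps)
  moreover have "Re (inverse h) = u / ((Re h)\<^sup>2 + (Im h)\<^sup>2)"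
    "Im (inverse h) / sqrt m = - v / ((Re h)\<^sup>2 + (Im h)\<^sup>2)"
    by (simp_all add: u_def v_def)
  ultimately show ?case using uv N
    by (auto simp: complex_ring_m_inv simp del: inverse_complex.sel intro!: Rats_divide)
next
  case (eng_mult x y)
  have "Im x * Im y = (Im x / sqrt m) * (Im y / sqrt m) * m"
    using m by simp
  moreover have "(Im x / sqrt m) * (Im y / sqrt m) * m \<in> \<rat>"
    using eng_mult.IH by (intro Rats_mult) auto
  ultimately have "Im x * Im y \<in> \<rat>" by metis
  then have "Re (x * y) \<in> \<rat>" using eng_mult.IH by simp
  moreover have "Im (x * y) / sqrt m = Re x * (Im y / sqrt m) + (Im x / sqrt m) * Re y"
    by (simp add: add_divide_distrib)
  moreover have "Re x * (Im y / sqrt m) + (Im x / sqrt m) * Re y \<in> \<rat>"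
    using eng_mult.IH by (intro Rats_add Rats_mult) auto
  ultimately show ?case unfolding complex_ring_simps by metis
qed (use m in \<open>auto simp: complex_ring_simps complex_ring_a_inv add_divide_distrib\<close>)

lemma imag_quadratic_field_divide:
  assumes "a \<in> imag_quadratic_field m" "b \<in> imag_quadratic_field m" "b \<noteq> 0"
  shows "a / b \<in> imag_quadratic_field m"
  using generate_field.eng_mult[OF assms(1)[unfolded imag_quadratic_field_def]
      generate_field.m_inv[OF assms(2)[unfolded imag_quadratic_field_def]]] assms(3)
  by (simp add: imag_quadratic_field_def complex_ring_simps complex_ring_m_inv field_class.field_divide_inverse)

text \<open>The coordinates make such an element rational, and a rational algebraic integer is an
  integer.\<close>

lemma real_mem_order_Ints:
  assumes m: "m > 0" and R: "R \<subseteq> imag_quadratic_integers m" and z: "z \<in> R" "Im z = 0"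
  obtains k where "z = of_int k"
proof -
  have "z \<in> imag_quadratic_field m" "algebraic_int z" using R z by (auto simp: imag_quadratic_integers_def)
  then have "Re z \<in> \<rat>" using imag_quadratic_field_coords[OF m] by blast
  then obtain i j where "Re z = of_int i / of_int j" by (auto simp: Rats_eq_int_div_int)
  then have "complex_of_real (Re z) \<in> \<rat>" by simp
  then have "z \<in> \<rat>" using z(2) by (simp add: complex_is_Real_iff of_real_Re)
  then show ?thesis using rational_algebraic_int_is_int[OF \<open>algebraic_int z\<close>] that by (auto elim: Ints_cases)
qed

section \<open>Discreteness of orders\<close>

lemma order_basis:
  assumes "free_int_module_of_rank 2 R"
  obtains b1 b2 where "R = {of_int i * b1 + of_int j * b2 |i j. True}"
    "\<And>i j. of_int i * b1 + of_int j * b2 = 0 \<Longrightarrow> i = 0 \<and> j = 0"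
proof -
  interpret int_module: Modules.module int_scale by (rule module_int_scale)
  obtain B where B: "finite B" "card B = 2" "\<not> int_module.dependent B" "int_module.span B = R"
    using assms by (auto simp: free_int_module_of_rank_def)
  obtain b1 b2 where b: "B = {b1, b2}" "b1 \<noteq> b2" using B(2) by (auto simp: card_2_iff)
  show ?thesis
  proof (rule that)
    have "R = range (\<lambda>u. \<Sum>v\<in>B. int_scale (u v) v)" using int_module.span_finite[OF B(1)] B(4) by simp
    also have "\<dots> = {of_int i * b1 + of_int j * b2 |i j. True}"
    proof (intro equalityI subsetI)
      fix x assume "x \<in> {of_int i * b1 + of_int j * b2 |i j. True}"
      then obtain i j where "x = of_int i * b1 + of_int j * b2" by blast
      then have "x = (\<Sum>v\<in>B. int_scale ((\<lambda>v. if v = b1 then i else j) v) v)" using b by simp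
      then show "x \<in> range (\<lambda>u. \<Sum>v\<in>B. int_scale (u v) v)"
        by (rule image_eqI[where f = "\<lambda>u. \<Sum>v\<in>B. int_scale (u v) v"]) simp
    qed (use b in auto)
    finally show "R = {of_int i * b1 + of_int j * b2 |i j. True}" .
    fix i j assume 0: "of_int i * b1 + of_int j * b2 = 0"
    have "(\<Sum>v\<in>B. int_scale (if v = b1 then i else j) v) = 0" using b 0 by simp
    moreover have "\<forall>v\<in>B. u v = 0" if "(\<Sum>v\<in>B. int_scale (u v) v) = 0" for u
      using B(3) that unfolding int_module.dependent_finite[OF B(1)] by blast
    ultimately have "\<forall>v\<in>B. (if v = b1 then i else j) = 0" by fast
    then show "i = 0 \<and> j = 0" using b by auto
  qed
qed

text \<open>An element \<open>z\<close> acts on an integral basis of the order by an integer matrix, so a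
  non-real \<open>z\<close> satisfies an integral quadratic equation whose constant term is its norm.\<close>

lemma order_norm_ge_1:
  assumes m: "m > 0" and R: "R \<subseteq> imag_quadratic_integers m" and rank: "free_int_module_of_rank 2 R"
    and mult: "\<And>x y. x \<in> R \<Longrightarrow> y \<in> R \<Longrightarrow> x * y \<in> R"
    and z: "z \<in> R" "z \<noteq> 0"
  shows "1 \<le> norm z"
proof (cases "Im z = 0")
  case True
  then obtain k where "z = of_int k" using real_mem_order_Ints[OF m R z(1)] by blast
  then show ?thesis using z(2) by (simp flip: of_int_abs)
next
  case False
  obtain b1 b2 where b: "R = {of_int i * b1 + of_int j * b2 |i j. True}"
    "\<And>i j. of_int i * b1 + of_int j * b2 = 0 \<Longrightarrow> i = 0 \<and> j = 0" using order_basis[OF rank] by blast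
  have "b1 = of_int 1 * b1 + of_int 0 * b2" "b2 = of_int 0 * b1 + of_int 1 * b2" by simp_all
  then have bR: "b1 \<in> R" "b2 \<in> R" using b(1) by blast+
  have b1: "b1 \<noteq> 0" using b(2)[of 1 0] by auto
  obtain i j where ij: "z * b1 = of_int i * b1 + of_int j * b2" using mult[OF z(1) bR(1)] b(1) by blast
  obtain k l where kl: "z * b2 = of_int k * b1 + of_int l * b2" using mult[OF z(1) bR(2)] b(1) by blast
  have "(z - of_int i) * b1 = of_int j * b2" "(z - of_int l) * b2 = of_int k * b1"
    using ij kl by (simp_all add: algebra_simps)
  then have "(z - of_int l) * ((z - of_int i) * b1) = of_int j * (of_int k * b1)"
    by (simp add: mult.left_commute)
  then have "(z - of_int l) * (z - of_int i) = of_int (j * k)" using b1 by simp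
  then have eq: "z * z - of_int (i + l) * z + of_int (i * l - j * k) = 0" by (simp add: algebra_simps)
  define T N where "T = i + l" and "N = i * l - j * k"
  have "Re (z * z - of_int T * z + of_int N) = 0" "Im (z * z - of_int T * z + of_int N) = 0"
    using eq by (simp_all only: T_def N_def zero_complex.sel)
  then have 1: "Re z * Re z - Im z * Im z - of_int T * Re z + of_int N = 0" "2 * (Re z * Im z) - of_int T * Im z = 0"
    by simp_all
  \<comment> \<open>The imaginary part of the equation gives the trace; the real part then gives
    \<open>N = |z|^2\<close>, a positive integer.\<close>
  then have "of_int T = 2 * Re z" using False by (simp add: algebra_simps)
  then have N: "of_int N = (Re z)\<^sup>2 + (Im z)\<^sup>2" using 1(1) by (simp add: power2_eq_square)
  have "(Re z)\<^sup>2 + (Im z)\<^sup>2 > 0" using False by (simp add: sum_power2_gt_zero_iff)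
  then have "N \<ge> 1" using N by linarith
  then have "1 \<le> (norm z)\<^sup>2" unfolding cmod_power2 N[symmetric] by simp
  then show ?thesis using abs_le_square_iff[of 1 "norm z"] by simp
qed

text \<open>A real order would lie in the integers, where any two elements are linearly
  dependent.\<close>

lemma order_nonreal:
  assumes m: "m > 0" and R: "R \<subseteq> imag_quadratic_integers m" and rank: "free_int_module_of_rank 2 R"
  obtains w where "w \<in> R" "Im w \<noteq> 0"
proof (rule ccontr)
  assume "\<not> thesis"
  with that have real: "\<And>z. z \<in> R \<Longrightarrow> Im z = 0" by blast
  obtain b1 b2 where b: "R = {of_int i * b1 + of_int j * b2 |i j. True}"
    "\<And>i j. of_int i * b1 + of_int j * b2 = 0 \<Longrightarrow> i = 0 \<and> j = 0" using order_basis[OF rank] by blast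
  have "b1 = of_int 1 * b1 + of_int 0 * b2" "b2 = of_int 0 * b1 + of_int 1 * b2" by simp_all
  then have bR: "b1 \<in> R" "b2 \<in> R" using b(1) by blast+
  obtain k l where "b1 = of_int k" "b2 = of_int l"
    using real_mem_order_Ints[OF m R] bR real by metis
  then show False using b(2)[of l "- k"] b(2)[of 1 0] by auto
qed

section \<open>Comparison with the given definitions\<close>

context quadratic_ideal
begin

text \<open>\<open>1\<close> and \<open>w\<close> form a basis of the field over the rationals;
  \<open>sqrt m\<close> cancels in the coefficient \<open>B\<close>.\<close>

lemma fracs_eq_field:
  assumes m: "m > 0" and R: "R \<subseteq> imag_quadratic_integers m"
  shows "fracs = imag_quadratic_field m"
proof (intro equalityI subsetI)
  fix z assume "z \<in> fracs"
  then show "z \<in> imag_quadratic_field m"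
    unfolding fracs_def using R imag_quadratic_field_divide[of _ m]
    by (clarsimp simp: imag_quadratic_integers_def) blast
next
  fix z assume "z \<in> imag_quadratic_field m"
  then have z: "Re z \<in> \<rat>" "Im z / sqrt m \<in> \<rat>" using imag_quadratic_field_coords[OF m] by blast+
  have "w \<in> imag_quadratic_field m" using w_mem R by (auto simp: imag_quadratic_integers_def)
  then have w: "Re w \<in> \<rat>" "Im w / sqrt m \<in> \<rat>" using imag_quadratic_field_coords[OF m] by blast+
  define B where "B = (Im z / sqrt m) / (Im w / sqrt m)"
  define A where "A = Re z - B * Re w"
  have "B \<in> \<rat>" unfolding B_def using z(2) w(2) by (rule Rats_divide)
  moreover from this have "A \<in> \<rat>" unfolding A_def using z(1) w(1) by (intro Rats_diff Rats_mult)
  ultimately obtain i k j l where A: "A = of_int i / of_int k" "k \<noteq> 0" and B: "B = of_int j / of_int l" "l \<noteq> 0"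
    unfolding Rats_eq_int_div_int by blast
  have "B * Im w = Im z" using Im_w m by (simp add: B_def)
  then have "z = of_real A + of_real B * w" by (simp add: complex_eq_iff A_def)
  also have "\<dots> = (of_int (i * l) + of_int (j * k) * w) / of_int (k * l)"
    using A(2) B(2) by (simp add: A B field_simps)
  finally have "z = (of_int (i * l) + of_int (j * k) * w) / of_int (k * l)" .
  moreover have "of_int (k * l) \<noteq> (0::complex)" using A B by simp
  ultimately show "z \<in> fracs" unfolding fracs_def using of_int_mem add_mem mult_mem w_mem by blast
qed

text \<open>The combinations of \<open>p\<close> and \<open>q\<close> form an ideal, hence contain
  the generated one; the latter is the whole ring exactly when 1 is such a combination.\<close>

lemma admissible_pairs_eq:
  assumes "subring R complex_ring"
  shows "admissible_pairs R I = E"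
proof -
  interpret ring "ring_on R"
    using ring.subring_is_ring[OF ring_from_type_algebra assms] .
  have "Idl\<^bsub>ring_on R\<^esub> {p, q} = R \<longleftrightarrow> (\<exists>a\<in>R. \<exists>b\<in>R. a * p + b * q = 1)" if pq: "p \<in> R" "q \<in> R" for p q
  proof
    define J where "J = {a * p + b * q |a b. a \<in> R \<and> b \<in> R}"
    have "ideal J (ring_on R)"
    proof (rule idealI[OF ring_axioms])
      have JR: "J \<subseteq> R" unfolding J_def using pq by (auto intro!: R_closed)
      have add: "x + y \<in> J" if "x \<in> J" "y \<in> J" for x y
      proof -
        obtain a b a' b' where "a \<in> R" "b \<in> R" "a' \<in> R" "b' \<in> R" "x = a * p + b * q" "y = a' * p + b' * q"
          using \<open>x \<in> J\<close> \<open>y \<in> J\<close> unfolding J_def by blast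
        then have "x + y = (a + a') * p + (b + b') * q" "a + a' \<in> R" "b + b' \<in> R" by (auto simp: algebra_simps add_mem)
        then show ?thesis unfolding J_def by blast
      qed
      have mul: "r * x \<in> J" if "x \<in> J" "r \<in> R" for r x
      proof -
        obtain a b where "a \<in> R" "b \<in> R" "x = a * p + b * q" using \<open>x \<in> J\<close> unfolding J_def by blast
        then have "r * x = (r * a) * p + (r * b) * q" "r * a \<in> R" "r * b \<in> R" using \<open>r \<in> R\<close> by (auto simp: algebra_simps mult_mem)
        then show ?thesis unfolding J_def by blast
      qed
      have "0 * p + 0 * q \<in> J" unfolding J_def using zero_mem by blast
      then have J0: "0 \<in> J" by simp
      show "subgroup J (add_monoid (ring_on R))"
      proof (rule add.subgroupI)
        show "J \<subseteq> carrier (ring_on R)" using JR by (simp add: ring_on_simps complex_ring_simps)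
        show "J \<noteq> {}" using J0 by blast
        show "x \<oplus>\<^bsub>ring_on R\<^esub> y \<in> J" if "x \<in> J" "y \<in> J" for x y using add that by (simp add: ring_on_simps complex_ring_simps)
        show "\<ominus>\<^bsub>ring_on R\<^esub> x \<in> J" if "x \<in> J" for x
        proof -
          have "(-1) * x \<in> J" using mul[OF that] uminus_mem[OF one_mem] by blast
          moreover have "\<ominus>\<^bsub>ring_on R\<^esub> x = - x"
            using \<open>x \<in> J\<close> JR by (intro minus_equality) (auto simp: ring_on_simps complex_ring_simps uminus_mem)
          ultimately show ?thesis by simp
        qed
      qed
      show "r \<otimes>\<^bsub>ring_on R\<^esub> x \<in> J" "x \<otimes>\<^bsub>ring_on R\<^esub> r \<in> J" if "x \<in> J" "r \<in> carrier (ring_on R)" for x r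
        using mul[of x r] that by (simp_all add: ring_on_simps complex_ring_simps mult.commute)
    qed
    moreover have "1 * p + 0 * q \<in> J" "0 * p + 1 * q \<in> J" unfolding J_def using zero_mem one_mem by blast+
    ultimately have "Idl\<^bsub>ring_on R\<^esub> {p, q} \<subseteq> J" by (intro genideal_minimal) auto
    then show "\<exists>a\<in>R. \<exists>b\<in>R. a * p + b * q = 1" if "Idl\<^bsub>ring_on R\<^esub> {p, q} = R"
      using one_mem that unfolding J_def by fastforce
  next
    assume "\<exists>a\<in>R. \<exists>b\<in>R. a * p + b * q = 1"
    then obtain a b where ab: "a \<in> R" "b \<in> R" "a * p + b * q = 1" by blast
    have sub: "{p, q} \<subseteq> carrier (ring_on R)" using pq by (simp add: ring_on_simps complex_ring_simps)
    interpret K: ideal "Idl\<^bsub>ring_on R\<^esub> {p, q}" "ring_on R" by (rule genideal_ideal[OF sub])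
    have "p \<in> Idl\<^bsub>ring_on R\<^esub> {p, q}" "q \<in> Idl\<^bsub>ring_on R\<^esub> {p, q}" using genideal_self[OF sub] by auto
    then have "a * p + b * q \<in> Idl\<^bsub>ring_on R\<^esub> {p, q}"
      using K.I_l_closed[of p a] K.I_l_closed[of q b] additive_subgroup.a_closed[OF K.additive_subgroup_axioms, of "a * p" "b * q"] ab by (simp add: ring_on_simps complex_ring_simps)
    then show "Idl\<^bsub>ring_on R\<^esub> {p, q} = R"
      using K.one_imp_carrier ab(3) by (simp add: ring_on_simps complex_ring_simps)
  qed
  then show ?thesis unfolding admissible_pairs_def E_def using I_mem by auto
qed

lemma approx_const_eq:
  assumes adm: "admissible_pairs R I = E" and lim: "is_liminf x k"
  shows "approx_const R I x = ereal k"
proof -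
  let ?A = "\<lambda>T. {(p, q) \<in> admissible_pairs R I. norm q \<ge> T}"
  let ?f = "\<lambda>pq. ereal ((norm (snd pq))\<^sup>2 * norm (x - fst pq / snd pq))"
  have f: "?f (p, q) = ereal (norm q * norm (p - x * q))" if "q \<noteq> 0" for p q
  proof -
    have "p - x * q = - ((x - p / q) * q)" using that by (simp add: field_simps)
    then have "norm (p - x * q) = norm (x - p / q) * norm q" by (simp only: norm_minus_cancel norm_mult)
    then show ?thesis by (simp add: power2_eq_square)
  qed
  have "(SUP T. INF pq\<in>?A T. ?f pq) \<le> ereal k"
  proof (rule SUP_least, rule ereal_le_epsilon2)
    fix T e :: real assume "0 < e"
    \<comment> \<open>\<open>max T 1\<close> keeps \<open>q\<close> nonzero, so that the division
      can be cleared.\<close>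
    then obtain p q where pq: "(p, q) \<in> E" "max T 1 \<le> norm q" "norm q * norm (p - x * q) < k + e"
      using lim unfolding is_liminf_def by meson
    have "(INF pq\<in>?A T. ?f pq) \<le> ?f (p, q)" using pq by (intro INF_lower) (auto simp: adm)
    also have "\<dots> = ereal (norm q * norm (p - x * q))" using pq(2) by (intro f) auto
    also have "\<dots> \<le> ereal k + ereal e" using pq(3) by simp
    finally show "(INF pq\<in>?A T. ?f pq) \<le> ereal k + ereal e" .
  qed
  moreover have "ereal k \<le> (SUP T. INF pq\<in>?A T. ?f pq)"
  proof (rule ereal_le_epsilon2)
    fix e :: real assume "0 < e"
    then obtain Q where Q: "\<And>p q. (p, q) \<in> E \<Longrightarrow> Q \<le> norm q \<Longrightarrow> k - e < norm q * norm (p - x * q)"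
      using lim unfolding is_liminf_def by meson
    have "ereal (k - e) \<le> (INF pq\<in>?A (max Q 1). ?f pq)"
    proof (rule INF_greatest)
      fix v assume v: "v \<in> ?A (max Q 1)"
      obtain p q where pq: "v = (p, q)" by (metis surj_pair)
      have "(p, q) \<in> E" "Q \<le> norm q" "q \<noteq> 0" using v by (auto simp: pq adm)
      then show "ereal (k - e) \<le> ?f v" unfolding pq using Q[of p q] f[of q p] by simp
    qed
    also have "\<dots> \<le> (SUP T. INF pq\<in>?A T. ?f pq)" by (rule SUP_upper) simp
    finally have "ereal (k - e) + ereal e \<le> (SUP T. INF pq\<in>?A T. ?f pq) + ereal e" by (rule add_right_mono)
    then show "ereal k \<le> (SUP T. INF pq\<in>?A T. ?f pq) + ereal e" by simp
  qed
  ultimately show ?thesis unfolding approx_const_altdef by (rule antisym)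
qed

text \<open>Relies on \<open>liminf_exists\<close>: a point without a finite lower limit would put
  an infinite value into the spectrum.\<close>

lemma approx_spectrum_eq:
  assumes "admissible_pairs R I = E" "fracs = imag_quadratic_field m"
  shows "approx_spectrum m R I = ereal ` {k. \<exists>x. x \<notin> fracs \<and> is_liminf x k}"
  unfolding approx_spectrum_def assms(2)[symmetric]
proof (intro equalityI subsetI)
  fix c assume "c \<in> approx_const R I ` (UNIV - fracs)"
  then obtain x where x: "x \<notin> fracs" "c = approx_const R I x" by blast
  obtain k where "is_liminf x k" using liminf_exists[OF x(1)] by blast
  then show "c \<in> ereal ` {k. \<exists>x. x \<notin> fracs \<and> is_liminf x k}"
    using x approx_const_eq[OF assms(1)] by blast
next
  fix c assume "c \<in> ereal ` {k. \<exists>x. x \<notin> fracs \<and> is_liminf x k}"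
  then obtain k x where "c = ereal k" "x \<notin> fracs" "is_liminf x k" by blast
  then show "c \<in> approx_const R I ` (UNIV - fracs)"
    using approx_const_eq[OF assms(1)] by (metis DiffI UNIV_I imageI)
qed

end

theorem theorem4:
  fixes m :: nat and R I :: "complex set"
  assumes "m > 0" and "squarefree m"
    and "imag_quadratic_order m R"
    and "ideal I (ring_on R)" and "I \<noteq> {0}"
  shows "approx_spectrum m R I \<subseteq> range ereal \<and> closed (ereal -` approx_spectrum m R I)"
proof -
  have R: "subring R complex_ring" "R \<subseteq> imag_quadratic_integers m" "free_int_module_of_rank 2 R"
    using assms(3) by (auto simp: imag_quadratic_order_def)
  note sub = subringE[OF R(1), unfolded complex_ring_simps complex_ring_a_inv]
  obtain w where w: "w \<in> R" "Im w \<noteq> 0" using order_nonreal[OF assms(1) R(2,3)] by blast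
  interpret I: ideal I "ring_on R" by fact
  interpret quadratic_ideal R I w
  proof
    show "1 \<in> R" by (rule sub(3))
    show "a - b \<in> R" if "a \<in> R" "b \<in> R" for a b using sub(7)[OF that(1) sub(5)[OF that(2)]] by simp
    show "a * b \<in> R" if "a \<in> R" "b \<in> R" for a b using sub(6) that .
    show "1 \<le> norm a" if "a \<in> R" "a \<noteq> 0" for a
      using order_norm_ge_1[OF assms(1) R(2,3) sub(6) that] .
    show "I \<subseteq> R" using additive_subgroup.a_subset[OF I.additive_subgroup_axioms] by (simp add: ring_on_simps complex_ring_simps)
    show "a + b \<in> I" if "a \<in> I" "b \<in> I" for a b using additive_subgroup.a_closed[OF I.additive_subgroup_axioms that] by (simp add: ring_on_simps complex_ring_simps)
    show "a * b \<in> I" if "a \<in> R" "b \<in> I" for a b using I.I_l_closed[of b a] that by (simp add: ring_on_simps complex_ring_simps)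
    show "\<exists>t\<in>I. t \<noteq> 0" using additive_subgroup.zero_closed[OF I.additive_subgroup_axioms] assms(5) by (auto simp: ring_on_simps complex_ring_simps)
  qed (fact w)+
  have "approx_spectrum m R I = ereal ` {k. \<exists>x. x \<notin> fracs \<and> is_liminf x k}"
    by (rule approx_spectrum_eq[OF admissible_pairs_eq[OF R(1)] fracs_eq_field[OF assms(1) R(2)]])
  moreover have "ereal -` ereal ` {k. \<exists>x. x \<notin> fracs \<and> is_liminf x k} = {k. \<exists>x. x \<notin> fracs \<and> is_liminf x k}"
    by (rule inj_vimage_image_eq) (simp add: inj_on_def)
  ultimately show ?thesis using closed_liminf by auto
qed

end
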